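(* Let $\theta\in(0,1]$ and let $L=(L_t)_{t\in[0,T)}$ be a càdlàg martingale with $L_t\in L_2$ for all $t\in[0,T)$. Assume that $\|[L;\tau]\|_{\mathrm{BMO}_1([0,T))}<\infty$ for all $\tau\in\mathcal T$ and that $\|[L;\tau]\|_{\mathrm{BMO}_1([0,T))}\to0$ as $\|\tau\|_1\to0$. Then the following assertions are equivalent: (1) $\displaystyle\inf_{t\in(0,T)}(T-t)^{\frac{1-\theta}{2}}\,\underline{\mathrm{Osc}}_t(L)>0$. (2) There is a $c>0$ such that for all $\tau\in\mathcal T$ one has $\|[L;\tau]\|_{\mathrm{BMO}_1([0,T))}\ge c\,\|\tau\|_\theta$.
   Context: Fix $T\in(0,\infty)$ and a complete probability space $(\Omega,\mathcal F,\mathbb P)$ with a right-continuous filtration $(\mathcal F_t)_{t\in[0,T]}$ such that $\mathcal F_0$ is generated by the $\mathbb P$-null sets and $\mathcal F=\mathcal F_T$. $\mathbb E^{\mathcal G}[\cdot]$ denotes (extended) conditional expectation given $\mathcal G$. $\mathcal T$ is the set of all deterministic time-nets $\tau=\{t_i\}_{i=0}^n$ with $0=t_0<t_1<\dots<t_n=T$, $n\in\mathbb N$, and for $\theta\in(0,1]$, $\|\tau\|_\theta:=\sup_{i=1,\dots,n}\frac{t_i-t_{i-1}}{(T-t_{i-1})^{1-\theta}}$ (so $\|\tau\|_1$ is the usual mesh-size). For $a\in[0,T)$, $[L;\tau]_a:=\int_0^a\big|L_u-\sum_{i=1}^nL_{t_{i-1}}\mathbf 1_{(t_{i-1},t_i]}(u)\big|^2du$,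 and $[L;\tau]$ is the process $([L;\tau]_a)_{a\in[0,T)}$. For an adapted càdlàg process $Y=(Y_t)_{t\in[0,T)}$ with $Y_0\equiv0$, $\|Y\|_{\mathrm{BMO}_1([0,T))}$ is the infimum of all $c\in[0,\infty)$ such that $\mathbb E^{\mathcal F_\rho}[|Y_t-Y_{\rho-}|]\le c$ a.s. for all $t\in[0,T)$ and all stopping times $\rho:\Omega\to[0,t]$ ($Y_{0-}:=Y_0$, $\inf\emptyset:=\infty$). For a stochastic process $L$ and $t\in(0,T)$, $\underline{\mathrm{Osc}}_t(L):=\inf_{s\in[0,t)}\|L_t-L_s\|_{L_\infty}\in[0,\infty]$. *)

theory Defs
  imports "HOL-Probability.Probability"
begin

(* The filtration is indexed by [0,T].  Since the library's filtration, stopping_time and pre_sigma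
   index over a whole type, F is extended to all reals by freezing it outside [0,T]; for stopping
   times with values in [0,T] this changes neither the notion of stopping time nor F_rho.  Only the
   sigma-algebra of each F t matters, never its measure. *)
locale stochastic_basis =
  prob_space M + complete_measure M + filtration "space M" F
  for M :: "'a measure" and F :: "real \<Rightarrow> 'a measure" +
  fixes T :: real
  assumes T_pos: "0 < T"
    and F_before: "\<And>t. t \<le> 0 \<Longrightarrow> sets (F t) = sets (F 0)"
    and F_initial: "sets (F 0) = sigma_sets (space M) (null_sets M)"
    and F_terminal: "\<And>t. T \<le> t \<Longrightarrow> sets (F t) = sets M"
    and F_right_continuous:
      "\<And>t. 0 \<le> t \<Longrightarrow> t < T \<Longrightarrow> sets (F t) = (\<Inter>s\<in>{t<..T}. sets (F s))"
begin

(* In particular nn_cond_exp M (pre_sigma \<rho>) is not the library's default value 0 for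
   non-subalgebras. *)
lemma subalgebra_pre_sigma:
  assumes \<rho>: "stopping_time F \<rho>" and le: "\<And>\<omega>. \<omega> \<in> space M \<Longrightarrow> \<rho> \<omega> \<le> T"
  shows "subalgebra M (pre_sigma \<rho>)"
proof -
  have "A \<in> sets M" if A: "A \<in> sets (pre_sigma \<rho>)" for A
  proof -
    have "A \<subseteq> space M"
      using sets.sets_into_space[OF A] by (simp add: space_pre_sigma)
    then have "{\<omega> \<in> A. \<rho> \<omega> \<le> T} = A"
      using le by auto
    then show ?thesis
      using sets_pre_sigmaD[OF \<rho> A, of T] F_terminal[of T] by simp
  qed
  then show ?thesis
    by (auto simp: subalgebra_def space_pre_sigma)
qed

end

text \<open>Processes \<open>(Y\<^sub>t)\<close> with \<open>t \<in> [0,T)\<close> are functions \<open>Y :: real \<Rightarrow> 'a \<Rightarrow> real\<close>; values at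
  times outside \<open>[0,T)\<close> are irrelevant.\<close>

definition adapted :: "(real \<Rightarrow> 'a measure) \<Rightarrow> real \<Rightarrow> (real \<Rightarrow> 'a \<Rightarrow> real) \<Rightarrow> bool" where
  "adapted F T Y \<longleftrightarrow> (\<forall>t\<in>{0..<T}. Y t \<in> borel_measurable (F t))"

definition cadlag :: "'a measure \<Rightarrow> real \<Rightarrow> (real \<Rightarrow> 'a \<Rightarrow> real) \<Rightarrow> bool" where
  "cadlag M T Y \<longleftrightarrow> (\<forall>\<omega>\<in>space M.
     (\<forall>t\<in>{0..<T}. ((\<lambda>s. Y s \<omega>) \<longlongrightarrow> Y t \<omega>) (at_right t)) \<and>
     (\<forall>t\<in>{0<..<T}. \<exists>l. ((\<lambda>s. Y s \<omega>) \<longlongrightarrow> l) (at_left t)))"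

definition martingale ::
  "'a measure \<Rightarrow> (real \<Rightarrow> 'a measure) \<Rightarrow> real \<Rightarrow> (real \<Rightarrow> 'a \<Rightarrow> real) \<Rightarrow> bool" where
  "martingale M F T Y \<longleftrightarrow> adapted F T Y \<and> (\<forall>t\<in>{0..<T}. integrable M (Y t)) \<and>
     (\<forall>t\<in>{0..<T}. \<forall>s\<in>{0..t}. AE \<omega> in M. real_cond_exp M (F s) (Y t) \<omega> = Y s \<omega>)"

definition left_limit :: "(real \<Rightarrow> 'a \<Rightarrow> real) \<Rightarrow> real \<Rightarrow> 'a \<Rightarrow> real" where
  "left_limit Y t \<omega> = (if t \<le> 0 then Y 0 \<omega> else Lim (at_left t) (\<lambda>s. Y s \<omega>))"

text \<open>The value is meaningful for adapted cadlag processes with \<open>Y\<^sub>0 = 0\<close>.\<close>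

definition BMO1_norm ::
  "'a measure \<Rightarrow> (real \<Rightarrow> 'a measure) \<Rightarrow> real \<Rightarrow> (real \<Rightarrow> 'a \<Rightarrow> real) \<Rightarrow> ennreal" where
  "BMO1_norm M F T Y = Inf (ennreal ` {c. 0 \<le> c \<and>
     (\<forall>t\<in>{0..<T}. \<forall>\<rho>. stopping_time F \<rho> \<and> (\<forall>\<omega>\<in>space M. \<rho> \<omega> \<in> {0..t}) \<longrightarrow>
        (AE \<omega> in M. nn_cond_exp M (filtration.pre_sigma (space M) F \<rho>)
           (\<lambda>\<omega>. ennreal \<bar>Y t \<omega> - left_limit Y (\<rho> \<omega>) \<omega>\<bar>) \<omega> \<le> ennreal c))})"

text \<open>A net \<open>0 = t\<^sub>0 < \<dots> < t\<^sub>n = T\<close> is the list \<open>[t\<^sub>0, \<dots>, t\<^sub>n]\<close>.\<close>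

definition time_nets :: "real \<Rightarrow> real list set" where
  "time_nets T = {\<tau>. \<tau> \<noteq> [] \<and> hd \<tau> = 0 \<and> last \<tau> = T \<and> sorted_wrt (<) \<tau>}"

definition mesh :: "real \<Rightarrow> real \<Rightarrow> real list \<Rightarrow> real" where
  "mesh T \<theta> \<tau> =
     (SUP i\<in>{1..<length \<tau>}. (\<tau> ! i - \<tau> ! (i - 1)) / (T - \<tau> ! (i - 1)) powr (1 - \<theta>))"

definition approx_error :: "(real \<Rightarrow> 'a \<Rightarrow> real) \<Rightarrow> real list \<Rightarrow> real \<Rightarrow> 'a \<Rightarrow> real" where
  "approx_error L \<tau> a \<omega> = set_lebesgue_integral lborel {0..a} (\<lambda>u.
     \<bar>L u \<omega> - (\<Sum>i\<in>{1..<length \<tau>}. L (\<tau> ! (i - 1)) \<omega> * indicator {\<tau> ! (i - 1)<..\<tau> ! i} u)\<bar>\<^sup>2)"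

definition lower_osc :: "'a measure \<Rightarrow> (real \<Rightarrow> 'a \<Rightarrow> real) \<Rightarrow> real \<Rightarrow> ennreal" where
  "lower_osc M L t = (INF s\<in>{0..<t}. esssup M (\<lambda>\<omega>. ennreal \<bar>L t \<omega> - L s \<omega>\<bar>))"

end

theory Submission
  imports Defs
begin

text \<open>Write \<open>s < t\<close> for neighbouring points of a net.  (1) \<open>\<Longrightarrow>\<close> (2): for deterministic times
  \<open>s < r < a < t\<close> the conditional expectation given \<open>F\<^sub>r\<close> of \<open>\<integral>\<^sub>r\<^sup>a (L\<^sub>u - L\<^sub>s)\<^sup>2 du\<close> is at least
  \<open>(a - r) (L\<^sub>r - L\<^sub>s)\<^sup>2\<close>, since \<open>(L\<^sub>u - L\<^sub>s)\<^sup>2\<close> is a submartingale in \<open>u \<ge> s\<close>; the oscillation bound at \<open>r\<close>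
  then gives a multiple of \<open>(t - s) / (T - s) powr (1 - \<theta>)\<close>.

  (2) \<open>\<Longrightarrow>\<close> (1): given \<open>r < t\<close>, take a very fine net through \<open>r\<close> and \<open>t\<close> and delete its points in
  between.  If \<open>\<bar>L\<^sub>t - L\<^sub>r\<bar> \<le> K\<close>, then \<open>\<bar>L\<^sub>u - L\<^sub>r\<bar> \<le> K\<close> on \<open>[r,t]\<close> by conditioning, so the BMO norm of the
  thinned net is at most \<open>\<epsilon> + (t - r) K\<^sup>2\<close>, whereas its \<open>\<theta>\<close>-mesh is at least that of the interval
  \<open>[r,t]\<close>.  Letting \<open>\<epsilon> \<rightarrow> 0\<close> bounds \<open>K\<close> from below.\<close>

subsection \<open>Time nets\<close>

text \<open>The strict bound \<open>\<tau> ! i < T\<close> below the last index places every left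
  end in \<open>[0,T)\<close>, the time set of the processes.\<close>

lemma time_netsD:
  assumes "\<tau> \<in> time_nets T" "0 < T"
  shows "2 \<le> length \<tau>" "\<tau> ! 0 = 0" "\<tau> ! (length \<tau> - 1) = T" "0 \<in> set \<tau>"
    and "\<And>i j. i < j \<Longrightarrow> j < length \<tau> \<Longrightarrow> \<tau> ! i < \<tau> ! j"
    and "\<And>i. i < length \<tau> \<Longrightarrow> 0 \<le> \<tau> ! i \<and> \<tau> ! i \<le> T"
    and "\<And>i. i < length \<tau> - 1 \<Longrightarrow> \<tau> ! i < T"
    and "\<And>i j. i \<le> j \<Longrightarrow> j < length \<tau> \<Longrightarrow> \<tau> ! i \<le> \<tau> ! j"
proof -
  have ne: "\<tau> \<noteq> []" and hd: "hd \<tau> = 0" and la: "last \<tau> = T" and so: "sorted_wrt (<) \<tau>"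
    using assms(1) by (auto simp: time_nets_def)
  show l: "\<tau> ! i < \<tau> ! j" if "i < j" "j < length \<tau>" for i j
    using so that by (simp add: sorted_wrt_nth_less)
  show h0: "\<tau> ! 0 = 0"
    using ne hd by (simp add: hd_conv_nth)
  show lT: "\<tau> ! (length \<tau> - 1) = T"
    using ne la by (simp add: last_conv_nth)
  have "length \<tau> \<noteq> 0" "length \<tau> \<noteq> 1"
    using ne h0 lT assms(2) by auto
  then show "2 \<le> length \<tau>"
    by linarith
  show "0 \<in> set \<tau>"
    using ne hd hd_in_set by metis
  show m: "\<tau> ! i \<le> \<tau> ! j" if "i \<le> j" "j < length \<tau>" for i j
    using l[of i j] that by (cases "i = j") auto
  show "\<tau> ! i < T" if "i < length \<tau> - 1" for i
    using l[of i "length \<tau> - 1"] lT that by simp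
  show "0 \<le> \<tau> ! i \<and> \<tau> ! i \<le> T" if "i < length \<tau>" for i
    using m[of 0 i] m[of i "length \<tau> - 1"] h0 lT that by simp
qed

text \<open>Left end of the net interval containing \<open>u\<close>. It depends only on the set of
  points, so nets can be compared after points are deleted. For \<open>u \<le> 0\<close> a net
  leaves the set empty, so only \<open>0 < u\<close> is meaningful.\<close>

definition net_left :: "real list \<Rightarrow> real \<Rightarrow> real" where
  "net_left \<tau> u = Max {p \<in> set \<tau>. p < u}"

lemma net_leftI:
  assumes "\<tau> \<in> time_nets T" "0 < T" "i \<in> {1..<length \<tau>}" "u \<in> {\<tau> ! (i - 1)<..\<tau> ! i}"
  shows "net_left \<tau> u = \<tau> ! (i - 1)"
  unfolding net_left_def
proof (rule Max_eqI)
  fix y assume "y \<in> {p \<in> set \<tau>. p < u}"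
  then obtain j where j: "j < length \<tau>" "y = \<tau> ! j" "\<tau> ! j < u"
    by (auto simp: in_set_conv_nth)
  then have "j < i"
    using time_netsD(5)[OF assms(1,2), of i j] assms(3,4) by (cases i j rule: linorder_cases) auto
  then show "y \<le> \<tau> ! (i - 1)"
    using time_netsD(8)[OF assms(1,2), of j "i - 1"] assms(3) j by force
qed (use assms(3,4) in auto)

lemma net_interval:
  assumes "\<tau> \<in> time_nets T" "0 < T" "0 < u" "u \<le> T"
  obtains i where "i \<in> {1..<length \<tau>}" "u \<in> {\<tau> ! (i - 1)<..\<tau> ! i}"
proof -
  note D = time_netsD[OF assms(1,2)]
  \<comment> \<open>Intervals are closed on the right, so the first point not below \<open>u\<close>
    is the right end sought; minimality puts its predecessor strictly below
    \<open>u\<close>.\<close>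
  define i where "i = (LEAST i. u \<le> \<tau> ! i)"
  have u: "u \<le> \<tau> ! (length \<tau> - 1)"
    using assms D by simp
  have 1: "u \<le> \<tau> ! i"
    unfolding i_def by (rule LeastI[of "\<lambda>i. u \<le> \<tau> ! i", OF u])
  have 2: "i \<le> length \<tau> - 1"
    unfolding i_def by (rule Least_le[of "\<lambda>i. u \<le> \<tau> ! i", OF u])
  have 3: "i \<noteq> 0"
    using 1 D(2) assms(3) by (metis not_le)
  have "\<not> u \<le> \<tau> ! (i - 1)"
    using 3 not_less_Least[of "i - 1" "\<lambda>i. u \<le> \<tau> ! i"] unfolding i_def[symmetric] by simp
  then show ?thesis
    using 1 2 3 D(1) by (intro that[of i]) auto
qed

lemma net_step_eq:
  fixes g :: "real \<Rightarrow> real"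
  assumes "\<tau> \<in> time_nets T" "0 < T" "0 < u" "u \<le> T"
  shows "(\<Sum>i\<in>{1..<length \<tau>}. g (\<tau> ! (i - 1)) * indicator {\<tau> ! (i - 1)<..\<tau> ! i} u) = g (net_left \<tau> u)"
proof -
  obtain i where i: "i \<in> {1..<length \<tau>}" "u \<in> {\<tau> ! (i - 1)<..\<tau> ! i}"
    using net_interval[OF assms] .
  \<comment> \<open>Two intervals containing \<open>u\<close> would share the left end
    \<open>net_left \<tau> u\<close>, against strict monotonicity. Hence a single summand
    survives.\<close>
  have *: "u \<notin> {\<tau> ! (j - 1)<..\<tau> ! j}" if j: "j \<in> {1..<length \<tau>} - {i}" for j
  proof
    assume "u \<in> {\<tau> ! (j - 1)<..\<tau> ! j}"
    then have "\<tau> ! (j - 1) = \<tau> ! (i - 1)"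
      using net_leftI[OF assms(1,2) i] net_leftI[OF assms(1,2), of j u] j by simp
    moreover have "i - 1 < j - 1 \<and> j - 1 < length \<tau> \<or> j - 1 < i - 1 \<and> i - 1 < length \<tau>"
      using i(1) j by auto
    ultimately show False
      using time_netsD(5)[OF assms(1,2), of "i-1" "j-1"] time_netsD(5)[OF assms(1,2), of "j-1" "i-1"]
      by auto
  qed
  have "(\<Sum>i\<in>{1..<length \<tau>}. g (\<tau> ! (i - 1)) * indicator {\<tau> ! (i - 1)<..\<tau> ! i} u)
      = (\<Sum>j\<in>{1..<length \<tau>}. if j = i then g (\<tau> ! (i - 1)) else 0)"
    by (rule sum.cong) (use i(2) * in \<open>auto simp: indicator_def\<close>)
  then show ?thesis
    using i(1) net_leftI[OF assms(1,2) i] by simp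
qed

lemma net_left_mem:
  assumes "\<tau> \<in> time_nets T" "0 < T" "0 < u"
  shows "net_left \<tau> u \<in> set \<tau>" "net_left \<tau> u < u"
proof -
  have "net_left \<tau> u \<in> {p \<in> set \<tau>. p < u}"
    unfolding net_left_def using time_netsD(4)[OF assms(1,2)] assms(3) by (intro Max_in) auto
  then show "net_left \<tau> u \<in> set \<tau>" "net_left \<tau> u < u"
    by auto
qed

text \<open>A deleted point can be the last one before \<open>u\<close> only if \<open>u\<close>
  lies in \<open>(r,t]\<close>: for \<open>u \<le> r\<close> it is not below \<open>u\<close>, and
  for \<open>u > t\<close> the surviving point \<open>t\<close> is larger.\<close>

lemma net_left_thin:
  assumes "\<tau> \<in> time_nets T" "0 < T"
    and "set \<tau> = set \<tau>' - {r<..<t}" "r \<in> set \<tau>" "t \<in> set \<tau>" "r < t" "0 < u"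
  shows "u \<notin> {r<..t} \<Longrightarrow> net_left \<tau> u = net_left \<tau>' u"
    and "u \<in> {r<..t} \<Longrightarrow> net_left \<tau> u = r"
proof -
  assume u: "u \<notin> {r<..t}"
  show "net_left \<tau> u = net_left \<tau>' u"
    unfolding net_left_def[of \<tau>']
  proof (rule Max_eqI[symmetric])
    show "net_left \<tau> u \<in> {p \<in> set \<tau>'. p < u}"
      using net_left_mem[OF assms(1,2,7)] assms(3) by auto
    fix y assume y: "y \<in> {p \<in> set \<tau>'. p < u}"
    define z where "z = (if y \<in> {r<..<t} then t else y)"
    have "z \<in> {p \<in> set \<tau>. p < u}" "y \<le> z"
      using y u assms(3,5) unfolding z_def by auto
    moreover have "z \<le> net_left \<tau> u"
      unfolding net_left_def by (rule Max_ge) (use calculation in auto)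
    ultimately show "y \<le> net_left \<tau> u"
      by simp
  qed simp
next
  assume u: "u \<in> {r<..t}"
  show "net_left \<tau> u = r"
    unfolding net_left_def by (rule Max_eqI) (use u assms(3,4) in auto)
qed

section \<open>Mesh size and the construction of fine nets\<close>

lemma mesh_ge:
  assumes "i \<in> {1..<length \<tau>}"
  shows "(\<tau> ! i - \<tau> ! (i - 1)) / (T - \<tau> ! (i - 1)) powr (1 - \<theta>) \<le> mesh T \<theta> \<tau>"
  unfolding mesh_def using assms by (intro cSUP_upper) auto

lemma mesh_attained:
  assumes "\<tau> \<in> time_nets T" "0 < T"
  obtains i where "i \<in> {1..<length \<tau>}"
    "mesh T \<theta> \<tau> = (\<tau> ! i - \<tau> ! (i - 1)) / (T - \<tau> ! (i - 1)) powr (1 - \<theta>)"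
proof -
  let ?g = "\<lambda>i. (\<tau> ! i - \<tau> ! (i - 1)) / (T - \<tau> ! (i - 1)) powr (1 - \<theta>)"
  have "{1..<length \<tau>} \<noteq> {}"
    using time_netsD(1)[OF assms] by auto
  then have "Max (?g ` {1..<length \<tau>}) \<in> ?g ` {1..<length \<tau>}"
    by (intro Max_in) auto
  moreover have "mesh T \<theta> \<tau> = Max (?g ` {1..<length \<tau>})"
    unfolding mesh_def using \<open>{1..<length \<tau>} \<noteq> {}\<close> by (intro cSup_eq_Max) auto
  ultimately show ?thesis
    using that by auto
qed

text \<open>Adding and deleting points are set operations, whereas the mesh refers to list
  positions; this passes from the one to the other.\<close>

lemma sorted_list_of_set_time_net:
  assumes "finite S" "S \<subseteq> {0..T}" "0 \<in> S" "T \<in> S"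
  shows "sorted_list_of_set S \<in> time_nets T"
proof -
  let ?l = "sorted_list_of_set S"
  have set: "set ?l = S" and so: "sorted ?l" and st: "sorted_wrt (<) ?l"
    using assms(1) by (auto)
  have ne: "?l \<noteq> []"
    using set assms(3) by auto
  have "hd ?l \<in> S" "last ?l \<in> S"
    using ne set by (metis hd_in_set, metis last_in_set)
  moreover obtain j k where "j < length ?l" "?l ! j = 0" "k < length ?l" "?l ! k = T"
    using assms(3,4) set by (metis in_set_conv_nth)
  then have "hd ?l \<le> 0" "T \<le> last ?l"
    using sorted_nth_mono[OF so, of 0 j] sorted_nth_mono[OF so, of k "length ?l - 1"] ne
    unfolding hd_conv_nth[OF ne] last_conv_nth[OF ne] by linarith+
  ultimately have "hd ?l = 0" "last ?l = T"
    using assms(2) by fastforce+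
  then show ?thesis
    using ne st by (simp add: time_nets_def)
qed

text \<open>The fine net is an equidistant grid with \<open>r\<close> and \<open>t\<close> added.
  After thinning, \<open>r\<close> and \<open>t\<close> are neighbours, so the quotient of
  \<open>[r,t]\<close> enters the supremum in the mesh, for every \<open>\<theta>\<close> at
  once.\<close>

lemma fine_time_nets:
  assumes T: "0 < T" and rt: "0 \<le> r" "r < t" "t < T" and \<delta>: "0 < \<delta>"
  obtains \<tau> \<tau>' where "\<tau> \<in> time_nets T" "\<tau>' \<in> time_nets T" "mesh T 1 \<tau>' < \<delta>"
    "set \<tau> = set \<tau>' - {r<..<t}" "r \<in> set \<tau>" "t \<in> set \<tau>"
    "\<And>\<theta>. (t - r) / (T - r) powr (1 - \<theta>) \<le> mesh T \<theta> \<tau>"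
proof -
  obtain N :: nat where N: "T / \<delta> < real N"
    using reals_Archimedean2 by blast
  have N0: "0 < N"
    using N T \<delta> by (metis divide_pos_pos gr0I less_asym of_nat_0)
  define h where "h = T / real N"
  have h: "0 < h" "h < \<delta>" "real N * h = T"
    unfolding h_def using N N0 T \<delta> by (auto simp: field_simps)
  define S' where "S' = {r, t} \<union> (\<lambda>k. real k * h) ` {..N}"
  define \<tau>' \<tau> where "\<tau>' = sorted_list_of_set S'" and "\<tau> = sorted_list_of_set (S' - {r<..<t})"
  have "real k * h \<le> T" if "k \<le> N" for k
    using mult_right_mono[of "real k" "real N" h] that h by simp
  then have S': "finite S'" "S' \<subseteq> {0..T}" "0 \<in> S'" "T \<in> S'"
    unfolding S'_def using rt h by (auto simp: image_iff intro!: bexI[of _ 0] bexI[of _ N])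
  have n': "\<tau>' \<in> time_nets T" and n: "\<tau> \<in> time_nets T"
    unfolding \<tau>'_def \<tau>_def using S' rt by (auto intro!: sorted_list_of_set_time_net)
  have s': "set \<tau>' = S'" and s: "set \<tau> = S' - {r<..<t}"
    unfolding \<tau>'_def \<tau>_def using S' by auto
  obtain i where i: "i \<in> {1..<length \<tau>'}"
    "mesh T 1 \<tau>' = (\<tau>' ! i - \<tau>' ! (i - 1)) / (T - \<tau>' ! (i - 1)) powr (1 - 1)"
    using mesh_attained[OF n' T] by metis
  note D' = time_netsD[OF n' T]
  define a where "a = \<tau>' ! (i - 1)"
  have a: "0 \<le> a" "a < T" "a < \<tau>' ! i"
    using D'(5)[of "i - 1" i] D'(6)[of "i - 1"] D'(7)[of "i - 1"] i(1) unfolding a_def by auto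
  \<comment> \<open>\<open>k * h\<close> is the last grid point not beyond \<open>a\<close>, the
    left end of an interval attaining the mesh. The next grid point lies in
    \<open>(a, a + h]\<close>, so the successor of \<open>a\<close> in the net is no further
    away.\<close>
  define k where "k = nat \<lfloor>a / h\<rfloor>"
  have k: "real k \<le> a / h" "a / h < real (Suc k)"
    unfolding k_def using a h by (auto simp: of_nat_nat) linarith+
  have "k < N"
  proof -
    have "real k < real N"
      using k(1) a h by (smt (verit) divide_less_eq mult.commute pos_divide_le_eq)
    then show ?thesis by simp
  qed
  then have "real (Suc k) * h \<in> set \<tau>'"
    unfolding s' S'_def by (intro UnI2 imageI) simp
  then obtain j where j: "j < length \<tau>'" "\<tau>' ! j = real (Suc k) * h"
    by (auto simp: in_set_conv_nth)
  have "a < \<tau>' ! j" "\<tau>' ! j \<le> a + h"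
    using k h unfolding j(2) by (auto simp: field_simps)
  then have "i - 1 < j"
    using D'(5)[of j "i - 1"] i(1) unfolding a_def
    by (metis atLeastLessThan_iff less_imp_diff_less less_irrefl linorder_neqE_nat order.asym)
  then have "\<tau>' ! i \<le> \<tau>' ! j"
    using D'(8)[of i j] j(1) by auto
  then have "\<tau>' ! i - a < \<delta>"
    using \<open>\<tau>' ! j \<le> a + h\<close> h by linarith
  then have m: "mesh T 1 \<tau>' < \<delta>"
    using i(2) a by (simp add: a_def)
  have rS: "r \<in> set \<tau>" "t \<in> set \<tau>"
    unfolding s S'_def by auto
  obtain i where i: "i \<in> {1..<length \<tau>}" "t \<in> {\<tau> ! (i - 1)<..\<tau> ! i}"
    using net_interval[OF n T, of t] rt by auto
  have "\<tau> ! (i - 1) = r"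
    using net_leftI[OF n T i] net_left_thin(2)[OF n T, of \<tau>' r t t] s s' rS rt by simp
  \<comment> \<open>\<open>t\<close> is itself a net point in the interval, and only the right end
    can be one.\<close>
  moreover have "\<tau> ! i = t"
  proof -
    obtain j where j: "j < length \<tau>" "\<tau> ! j = t"
      using rS by (auto simp: in_set_conv_nth)
    have "i \<le> j"
    proof (rule ccontr)
      assume "\<not> i \<le> j"
      then have "j \<le> i - 1" "i - 1 < length \<tau>" using i(1) by auto
      then show False
        using time_netsD(8)[OF n T, of j "i - 1"] i j by auto
    qed
    then show ?thesis
      using time_netsD(8)[OF n T, of i j] i j by auto
  qed
  ultimately have "(t - r) / (T - r) powr (1 - \<theta>) \<le> mesh T \<theta> \<tau>" for \<theta>
    using mesh_ge[OF i(1), of T \<theta>] by simp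
  then show ?thesis
    using n n' m rS s s' by (intro that[of \<tau> \<tau>']) auto
qed

subsection \<open>The approximation error as a process\<close>

text \<open>Approximation from the right, evaluating \<open>g\<close> at only countably many times
  in each stage.\<close>

lemma right_continuous_joint_measurable:
  fixes g :: "real \<Rightarrow> 'a \<Rightarrow> real"
  assumes [measurable]: "\<And>u. g u \<in> borel_measurable M"
    and lim: "\<And>u \<omega>. \<omega> \<in> space M \<Longrightarrow> ((\<lambda>s. g s \<omega>) \<longlongrightarrow> g u \<omega>) (at_right u)"
  shows "(\<lambda>(u, \<omega>). g u \<omega>) \<in> borel_measurable (borel \<Otimes>\<^sub>M M)"
proof (rule borel_measurable_LIMSEQ_real)
  \<comment> \<open>The least multiple of \<open>1 / real (Suc n)\<close> strictly above
    \<open>u\<close>. Strictness matters at grid points, since \<open>at_right u\<close> excludes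
    \<open>u\<close>.\<close>
  define d where "d n u = (real_of_int \<lfloor>real (Suc n) * u\<rfloor> + 1) / real (Suc n)" for n u
  show "(\<lambda>n. (\<lambda>(u, \<omega>). g (d n u) \<omega>) x) \<longlonglongrightarrow> (\<lambda>(u, \<omega>). g u \<omega>) x"
    if x: "x \<in> space (borel \<Otimes>\<^sub>M M)" for x
  proof -
    obtain u \<omega> where uw: "x = (u, \<omega>)" "\<omega> \<in> space M"
      using x by (auto simp: space_pair_measure)
    have gt: "u < d n u" for n
      unfolding d_def by (simp add: field_simps del: of_nat_Suc) linarith
    have le: "d n u \<le> u + 1 / real (Suc n)" for n
      unfolding d_def by (simp add: field_simps del: of_nat_Suc)
    have "(\<lambda>n. u + 1 / real (Suc n)) \<longlonglongrightarrow> u + 0"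
      by (intro tendsto_intros LIMSEQ_inverse_real_of_nat[unfolded inverse_eq_divide])
    then have "(\<lambda>n. d n u) \<longlonglongrightarrow> u"
      using gt le by (intro tendsto_sandwich[of "\<lambda>_. u" "\<lambda>n. d n u" sequentially "\<lambda>n. u + 1 / real (Suc n)"])
        (auto intro!: always_eventually less_imp_le)
    then have "filterlim (\<lambda>n. d n u) (at_right u) sequentially"
      using gt by (auto simp: filterlim_at less_imp_neq[symmetric])
    then show ?thesis
      using filterlim_compose[OF lim[OF uw(2), of u]] uw by simp
  qed
  show "(\<lambda>(u, \<omega>). g (d n u) \<omega>) \<in> borel_measurable (borel \<Otimes>\<^sub>M M)" for n
  proof -
    have "(\<lambda>x. (\<lambda>k x. g ((real_of_int k + 1) / real (Suc n)) (snd x)) \<lfloor>real (Suc n) * fst x\<rfloor> x)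
        \<in> borel_measurable (borel \<Otimes>\<^sub>M M)"
      by (rule measurable_compose_countable) measurable
    then show ?thesis
      by (simp add: d_def case_prod_beta)
  qed
qed

text \<open>Bisection: bounds pass to adjacent intervals joined together, and near each point the
  one-sided limits bound \<open>f\<close> on either side; the value at the point itself is added to
  the bound.\<close>

lemma bounded_if_one_sided_limits:
  fixes f :: "real \<Rightarrow> real"
  assumes "a \<le> b"
    and right: "\<And>x. a \<le> x \<Longrightarrow> x \<le> b \<Longrightarrow> \<exists>l. (f \<longlongrightarrow> l) (at_right x)"
    and left: "\<And>x. a \<le> x \<Longrightarrow> x \<le> b \<Longrightarrow> \<exists>l. (f \<longlongrightarrow> l) (at_left x)"
  shows "\<exists>B. \<forall>x\<in>{a..b}. \<bar>f x\<bar> \<le> B"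
  using \<open>a \<le> b\<close>
proof (induction rule: Bolzano)
  case (trans a b c)
  then obtain B C where "\<forall>x\<in>{a..b}. \<bar>f x\<bar> \<le> B" "\<forall>x\<in>{b..c}. \<bar>f x\<bar> \<le> C"
    by auto
  then have "\<forall>x\<in>{a..c}. \<bar>f x\<bar> \<le> max B C"
    by (metis atLeastAtMost_iff le_max_iff_disj linorder_linear)
  then show ?case ..
next
  case (local x)
  obtain l r where l: "(f \<longlongrightarrow> l) (at_left x)" and r: "(f \<longlongrightarrow> r) (at_right x)"
    using left right local by meson
  have "eventually (\<lambda>y. \<bar>f y\<bar> < \<bar>l\<bar> + 1) (at_left x)" "eventually (\<lambda>y. \<bar>f y\<bar> < \<bar>r\<bar> + 1) (at_right x)"
    using order_tendstoD(2)[OF tendsto_rabs[OF l]] order_tendstoD(2)[OF tendsto_rabs[OF r]] by auto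
  then obtain p q where p: "p < x" "\<And>y. p < y \<Longrightarrow> y < x \<Longrightarrow> \<bar>f y\<bar> < \<bar>l\<bar> + 1"
    and q: "x < q" "\<And>y. x < y \<Longrightarrow> y < q \<Longrightarrow> \<bar>f y\<bar> < \<bar>r\<bar> + 1"
    unfolding eventually_at_left_field eventually_at_right_field by blast
  define B where "B = max (\<bar>f x\<bar>) (max (\<bar>l\<bar> + 1) (\<bar>r\<bar> + 1))"
  show ?case
  proof (rule exI[of _ "min (x - p) (q - x)"], intro conjI allI impI)
    fix a b assume ab: "a \<le> x \<and> x \<le> b \<and> b - a < min (x - p) (q - x)"
    have "\<bar>f y\<bar> \<le> B" if "y \<in> {a..b}" for y
    proof (cases y x rule: linorder_cases)
      case less
      then show ?thesis using p(2)[of y] ab that unfolding B_def by auto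
    next
      case greater
      then show ?thesis using q(2)[of y] ab that unfolding B_def by auto
    qed (auto simp: B_def)
    then show "\<exists>B. \<forall>x\<in>{a..b}. \<bar>f x\<bar> \<le> B"
      by blast
  qed (use p q in auto)
qed

section \<open>The martingale, cut off outside \<open>[0,T)\<close>, and its paths\<close>

locale cadlag_martingale = stochastic_basis M F T for M :: "'a measure" and F T +
  fixes L :: "real \<Rightarrow> 'a \<Rightarrow> real"
  assumes L_cadlag: "cadlag M T L"
    and L_martingale: "martingale M F T L"
    and L_square: "\<And>t. 0 \<le> t \<Longrightarrow> t < T \<Longrightarrow> integrable M (\<lambda>\<omega>. (L t \<omega>)\<^sup>2)"
begin

lemma subalgebra_F: "subalgebra M (F t)"
proof -
  have "sets (F t) \<subseteq> sets (F (max t T))"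
    by (rule sets_F_mono) simp
  also have "\<dots> = sets M"
    by (rule F_terminal) simp
  finally show ?thesis
    by (simp add: subalgebra_def space_F)
qed

lemma L_F_measurable: "0 \<le> t \<Longrightarrow> t \<le> s \<Longrightarrow> t < T \<Longrightarrow> L t \<in> borel_measurable (F s)"
  using L_martingale sets_F_mono[of t s] space_F
  by (auto simp: martingale_def adapted_def intro: borel_measurable_subalgebra)

lemma L_measurable: "0 \<le> t \<Longrightarrow> t < T \<Longrightarrow> L t \<in> borel_measurable M"
  using measurable_from_subalg[OF subalgebra_F L_F_measurable] by blast

lemma L_integrable: "0 \<le> t \<Longrightarrow> t < T \<Longrightarrow> integrable M (L t)"
  using L_martingale by (auto simp: martingale_def)

lemma L_cond_exp:
  "0 \<le> s \<Longrightarrow> s \<le> t \<Longrightarrow> t < T \<Longrightarrow> AE \<omega> in M. real_cond_exp M (F s) (L t) \<omega> = L s \<omega>"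
  using L_martingale by (auto simp: martingale_def)

lemma sigma_finite_F: "sigma_finite_subalgebra M (F t)"
  by (intro finite_measure_subalgebra_is_sigma_finite finite_measure_subalgebra.intro
      finite_measure_axioms finite_measure_subalgebra_axioms.intro subalgebra_F)

text \<open>Outside \<open>[0,T)\<close> the process \<open>L\<close> is arbitrary, so measurability in time needs the cut-off.\<close>

definition L0 :: "real \<Rightarrow> 'a \<Rightarrow> real" where
  "L0 t \<omega> = (if 0 \<le> t \<and> t < T then L t \<omega> else 0)"

lemma L0_measurable: "L0 t \<in> borel_measurable M"
  using L_measurable[of t] by (cases "0 \<le> t \<and> t < T") (auto simp: L0_def[abs_def])

lemma L0_right_continuous:
  assumes "\<omega> \<in> space M"
  shows "((\<lambda>s. L0 s \<omega>) \<longlongrightarrow> L0 t \<omega>) (at_right t)"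
proof (cases "0 \<le> t \<and> t < T")
  case True
  then have "((\<lambda>s. L s \<omega>) \<longlongrightarrow> L t \<omega>) (at_right t)"
    using L_cadlag assms by (auto simp: cadlag_def)
  moreover have "eventually (\<lambda>s. L s \<omega> = L0 s \<omega>) (at_right t)"
    using True
    unfolding eventually_at_right_field L0_def by (intro exI[of _ T]) auto
  ultimately show ?thesis
    using True tendsto_cong[of "\<lambda>s. L s \<omega>" "\<lambda>s. L0 s \<omega>"] by (simp add: L0_def)
next
  case False
  then have "eventually (\<lambda>s. L0 s \<omega> = 0) (at_right t)"
    unfolding eventually_at_right_field L0_def using T_pos
    by (intro exI[of _ "if t < 0 then 0 else t + 1"]) auto
  then show ?thesis
    using False by (auto simp: L0_def intro: tendsto_eventually)
qed

text \<open>The cadlag condition gives no left limit at \<open>T\<close>, hence \<open>t < T\<close>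
  here and \<open>a < T\<close> in the pathwise bounds that follow.\<close>

lemma L0_left_limit:
  assumes "\<omega> \<in> space M" "t < T"
  shows "\<exists>l. ((\<lambda>s. L0 s \<omega>) \<longlongrightarrow> l) (at_left t)"
proof (cases "0 < t")
  case True
  then obtain l where "((\<lambda>s. L s \<omega>) \<longlongrightarrow> l) (at_left t)"
    using L_cadlag assms unfolding cadlag_def by force
  moreover have "eventually (\<lambda>s. L s \<omega> = L0 s \<omega>) (at_left t)"
    using True assms(2) unfolding eventually_at_left_field L0_def by (intro exI[of _ 0]) auto
  ultimately show ?thesis
    using tendsto_cong[of "\<lambda>s. L s \<omega>" "\<lambda>s. L0 s \<omega>"] by blast
next
  case False
  then have "eventually (\<lambda>s. L0 s \<omega> = 0) (at_left t)"
    unfolding eventually_at_left_field L0_def by (intro exI[of _ "t - 1"]) auto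
  then show ?thesis
    by (blast intro: tendsto_eventually)
qed

lemma L0_bounded:
  assumes "\<omega> \<in> space M" "0 \<le> a" "a < T"
  shows "\<exists>B. \<forall>u\<in>{0..a}. \<bar>L0 u \<omega>\<bar> \<le> B"
  using assms by (intro bounded_if_one_sided_limits) (auto intro: L0_right_continuous L0_left_limit)

lemma L0_joint_measurable: "(\<lambda>(u, \<omega>). L0 u \<omega>) \<in> borel_measurable (borel \<Otimes>\<^sub>M M)"
  by (intro right_continuous_joint_measurable L0_measurable L0_right_continuous)

text \<open>Integrand of the error, kept as a sum of indicators because joint measurability is
  immediate in this form.\<close>

definition sq_err :: "real list \<Rightarrow> real \<Rightarrow> 'a \<Rightarrow> real" where
  "sq_err \<tau> u \<omega> =
     (L0 u \<omega> - (\<Sum>i\<in>{1..<length \<tau>}. L0 (\<tau> ! (i - 1)) \<omega> * indicator {\<tau> ! (i - 1)<..\<tau> ! i} u))\<^sup>2"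

lemma sq_err_joint_measurable [measurable]:
  "(\<lambda>x. sq_err \<tau> (fst x) (snd x)) \<in> borel_measurable (borel \<Otimes>\<^sub>M M)"
proof -
  note [measurable] = L0_joint_measurable[unfolded case_prod_beta] L0_measurable
  show ?thesis
    unfolding sq_err_def by measurable
qed

lemma sq_err_nonneg: "0 \<le> sq_err \<tau> u \<omega>"
  by (simp add: sq_err_def)

lemma sq_err_bounded:
  assumes "\<omega> \<in> space M" "0 \<le> a" "a < T"
  obtains B where "0 \<le> B" "\<And>u. u \<in> {0..a} \<Longrightarrow> sq_err \<tau> u \<omega> \<le> B"
proof -
  obtain B where B: "\<forall>u\<in>{0..a}. \<bar>L0 u \<omega>\<bar> \<le> B"
    using L0_bounded[OF assms] by blast
  \<comment> \<open>All left ends are counted, even those beyond \<open>a\<close>: crude, but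
    independent of \<open>u\<close>.\<close>
  define C where "C = B + (\<Sum>i\<in>{1..<length \<tau>}. \<bar>L0 (\<tau> ! (i - 1)) \<omega>\<bar>)"
  have "sq_err \<tau> u \<omega> \<le> C\<^sup>2" if "u \<in> {0..a}" for u
  proof -
    let ?S = "\<Sum>i\<in>{1..<length \<tau>}. L0 (\<tau> ! (i - 1)) \<omega> * indicator {\<tau> ! (i - 1)<..\<tau> ! i} u"
    have "\<bar>?S\<bar> \<le> (\<Sum>i\<in>{1..<length \<tau>}. \<bar>L0 (\<tau> ! (i - 1)) \<omega>\<bar>)"
      by (rule order_trans[OF sum_abs], rule sum_mono) (auto simp: indicator_def)
    then have "\<bar>L0 u \<omega> - ?S\<bar> \<le> C"
      using B that unfolding C_def by fastforce
    then show ?thesis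
      unfolding sq_err_def using abs_le_square_iff[of "L0 u \<omega> - ?S" C] by simp
  qed
  then show ?thesis
    using that[of "C\<^sup>2"] by simp
qed

lemma sq_err_integrable:
  assumes "\<omega> \<in> space M" "0 \<le> b" "a < T" "A \<in> sets borel" "A \<subseteq> {b..a}"
  shows "integrable lborel (\<lambda>u. indicator A u * sq_err \<tau> u \<omega>)"
proof (cases "b \<le> a")
  case True
  obtain B where B: "\<And>u. u \<in> {0..a} \<Longrightarrow> sq_err \<tau> u \<omega> \<le> B"
    using sq_err_bounded[OF assms(1), of a \<tau>] True assms by (metis order.trans)
  have "(\<lambda>u. sq_err \<tau> u \<omega>) \<in> borel_measurable borel"
    using measurable_compose[OF measurable_Pair2'[OF assms(1)] sq_err_joint_measurable] by simp
  moreover have "emeasure lborel A < \<infinity>"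
    using emeasure_mono[OF assms(5), of lborel] True by (simp add: le_less_trans)
  ultimately have "integrable lborel (\<lambda>u. indicator A u *\<^sub>R sq_err \<tau> u \<omega>)"
    using assms B sq_err_nonneg
    by (intro integrableI_bounded_set_indicator[where B=B]) (auto intro!: AE_I2)
  then show ?thesis by simp
next
  case False
  then have "A = {}" using assms(5) by auto
  then show ?thesis by simp
qed

lemma approx_error_eq:
  assumes "\<tau> \<in> time_nets T" "a < T"
  shows "approx_error L \<tau> a \<omega> = (\<integral>u. indicator {0..a} u * sq_err \<tau> u \<omega> \<partial>lborel)"
proof -
  have "L (\<tau> ! (i - 1)) \<omega> = L0 (\<tau> ! (i - 1)) \<omega>" if "i \<in> {1..<length \<tau>}" for i
  proof -
    have "i - 1 < length \<tau>" "i - 1 < length \<tau> - 1"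
      using that by auto
    then show ?thesis
      using time_netsD(6,7)[OF assms(1) T_pos, of "i - 1"] by (simp add: L0_def)
  qed
  then have *: "(\<Sum>i\<in>{1..<length \<tau>}. L (\<tau> ! (i - 1)) \<omega> * indicator {\<tau> ! (i - 1)<..\<tau> ! i} u)
      = (\<Sum>i\<in>{1..<length \<tau>}. L0 (\<tau> ! (i - 1)) \<omega> * indicator {\<tau> ! (i - 1)<..\<tau> ! i} u)" for u
    by (intro sum.cong) auto
  show ?thesis
    unfolding approx_error_def set_lebesgue_integral_def sq_err_def * power2_abs
    using assms(2) by (intro Bochner_Integration.integral_cong) (auto simp: indicator_def L0_def)
qed

definition err_incr :: "real list \<Rightarrow> real \<Rightarrow> real \<Rightarrow> 'a \<Rightarrow> real" where
  "err_incr \<tau> b a \<omega> = (\<integral>u. indicator {b<..a} u * sq_err \<tau> u \<omega> \<partial>lborel)"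

lemma approx_error_diff:
  assumes "\<tau> \<in> time_nets T" "\<omega> \<in> space M" "0 \<le> b" "b \<le> a" "a < T"
  shows "approx_error L \<tau> a \<omega> - approx_error L \<tau> b \<omega> = err_incr \<tau> b a \<omega>"
proof -
  have "approx_error L \<tau> a \<omega> - approx_error L \<tau> b \<omega> =
      (\<integral>u. indicator {0..a} u * sq_err \<tau> u \<omega> - indicator {0..b} u * sq_err \<tau> u \<omega> \<partial>lborel)"
    using assms by (simp add: approx_error_eq)
      (intro Bochner_Integration.integral_diff[symmetric] sq_err_integrable[where b=0 and a=a]; auto)
  also have "\<dots> = err_incr \<tau> b a \<omega>"
    unfolding err_incr_def using assms
    by (intro Bochner_Integration.integral_cong) (auto simp: indicator_def)
  finally show ?thesis .
qed

text \<open>A pathwise Lipschitz estimate with one constant for all \<open>b\<close>, from which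
  left continuity of the error process follows.\<close>

lemma err_incr_bounds:
  assumes "\<omega> \<in> space M" "0 \<le> a" "a < T"
  obtains B where "\<And>b. 0 \<le> b \<Longrightarrow> b \<le> a \<Longrightarrow> err_incr \<tau> b a \<omega> \<le> B * (a - b)"
proof -
  obtain B where B: "0 \<le> B" "\<And>u. u \<in> {0..a} \<Longrightarrow> sq_err \<tau> u \<omega> \<le> B"
    using sq_err_bounded[OF assms] by blast
  have "err_incr \<tau> b a \<omega> \<le> B * (a - b)" if b: "0 \<le> b" "b \<le> a" for b
  proof -
    have "integrable lborel (\<lambda>u. indicator {b<..a} u * B)"
      using b by (intro integrable_mult_left integrable_real_indicator) auto
    then have "err_incr \<tau> b a \<omega> \<le> (\<integral>u. indicator {b<..a} u * B \<partial>lborel)"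
      unfolding err_incr_def using assms b B
      by (intro integral_mono sq_err_integrable[where b=b and a=a]) (auto simp: indicator_def)
    also have "\<dots> = B * (a - b)"
      using b by simp
    finally show ?thesis .
  qed
  then show ?thesis by (rule that)
qed

lemma err_incr_nonneg: "0 \<le> err_incr \<tau> b a \<omega>"
  unfolding err_incr_def by (intro integral_nonneg_AE) (auto simp: sq_err_nonneg)

text \<open>The error is an indefinite integral and thus has no jumps; the Lipschitz estimate
  squeezes it on the left of \<open>t\<close>. The left limit in the BMO norm can therefore be
  dropped.\<close>

lemma left_limit_approx_error:
  assumes "\<tau> \<in> time_nets T" "\<omega> \<in> space M" "0 \<le> t" "t < T"
  shows "left_limit (approx_error L \<tau>) t \<omega> = approx_error L \<tau> t \<omega>"
proof (cases "t = 0")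
  case False
  then have t: "0 < t" using assms by simp
  obtain B where B: "\<And>b. 0 \<le> b \<Longrightarrow> b \<le> t \<Longrightarrow> err_incr \<tau> b t \<omega> \<le> B * (t - b)"
    using err_incr_bounds[OF assms(2-4), of \<tau>] by blast
  have bnd: "approx_error L \<tau> t \<omega> - B * (t - s) \<le> approx_error L \<tau> s \<omega> \<and>
      approx_error L \<tau> s \<omega> \<le> approx_error L \<tau> t \<omega>" if "0 < s \<and> s < t" for s
    using approx_error_diff[OF assms(1,2), of s t] B[of s] err_incr_nonneg[of \<tau> s t \<omega>] assms that
    by linarith
  have ev: "eventually (\<lambda>s. 0 < s \<and> s < t) (at_left t)"
    using t unfolding eventually_at_left_field by (intro exI[of _ 0]) auto
  have "((\<lambda>s. approx_error L \<tau> t \<omega> - B * (t - s)) \<longlongrightarrow> approx_error L \<tau> t \<omega> - B * (t - t)) (at_left t)"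
    by (intro tendsto_intros)
  then have lim: "((\<lambda>s. approx_error L \<tau> t \<omega> - B * (t - s)) \<longlongrightarrow> approx_error L \<tau> t \<omega>) (at_left t)"
    by simp
  have lower: "eventually (\<lambda>s. approx_error L \<tau> t \<omega> - B * (t - s) \<le> approx_error L \<tau> s \<omega>) (at_left t)"
    using ev by eventually_elim (use bnd in blast)
  have upper: "eventually (\<lambda>s. approx_error L \<tau> s \<omega> \<le> approx_error L \<tau> t \<omega>) (at_left t)"
    using ev by eventually_elim (use bnd in blast)
  have "((\<lambda>s. approx_error L \<tau> s \<omega>) \<longlongrightarrow> approx_error L \<tau> t \<omega>) (at_left t)"
    by (rule tendsto_sandwich[OF lower upper lim tendsto_const])
  then show ?thesis
    using t by (simp add: left_limit_def tendsto_Lim trivial_limit_at_left_real)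
qed (simp add: left_limit_def)

lemma approx_error_increment:
  assumes "\<tau> \<in> time_nets T" "\<omega> \<in> space M" "0 \<le> b" "b \<le> a" "a < T"
  shows "\<bar>approx_error L \<tau> a \<omega> - left_limit (approx_error L \<tau>) b \<omega>\<bar> = err_incr \<tau> b a \<omega>"
  using approx_error_diff[OF assms] left_limit_approx_error[OF assms(1,2,3)] err_incr_nonneg[of \<tau> b a \<omega>] assms
  by simp

lemma err_incr_measurable:
  assumes [measurable]: "\<rho> \<in> borel_measurable M"
  shows "(\<lambda>\<omega>. err_incr \<tau> (\<rho> \<omega>) a \<omega>) \<in> borel_measurable M"
proof -
  have "(\<lambda>x. sq_err \<tau> (snd x) (fst x)) \<in> borel_measurable (M \<Otimes>\<^sub>M borel)"
    using measurable_compose[OF measurable_pair_swap' sq_err_joint_measurable]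
    by (simp add: case_prod_beta)
  then have [measurable]: "(\<lambda>x. sq_err \<tau> (snd x) (fst x)) \<in> borel_measurable (M \<Otimes>\<^sub>M lborel)"
    by simp
  \<comment> \<open>Written as a condition on \<open>b\<close> and \<open>u\<close>, the indicator
    is visibly jointly measurable even when \<open>b\<close> is the random time
    \<open>\<rho> \<omega>\<close>.\<close>
  have "indicator {b<..a} u = (if b < u \<and> u \<le> a then 1 else 0 :: real)" for b u
    by simp
  then show ?thesis
    unfolding err_incr_def by simp
qed

subsection \<open>Martingale estimates and the BMO norm\<close>

lemma L_product_integrable:
  assumes "0 \<le> s" "s < T" "0 \<le> t" "t < T"
  shows "integrable M (\<lambda>\<omega>. L s \<omega> * L t \<omega>)"
proof (rule Bochner_Integration.integrable_bound)
  note [measurable] = L_measurable[OF assms(1,2)] L_measurable[OF assms(3,4)]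
  show "integrable M (\<lambda>\<omega>. (L s \<omega>)\<^sup>2 + (L t \<omega>)\<^sup>2)"
    using L_square assms by auto
  show "(\<lambda>\<omega>. L s \<omega> * L t \<omega>) \<in> borel_measurable M"
    by measurable
  have "\<bar>x * y\<bar> \<le> x\<^sup>2 + y\<^sup>2" for x y :: real
    using sum_squares_bound[of "\<bar>x\<bar>" "\<bar>y\<bar>"] abs_ge_zero[of "x * y"]
    unfolding abs_mult power2_abs mult.assoc by linarith
  then show "AE \<omega> in M. norm (L s \<omega> * L t \<omega>) \<le> norm ((L s \<omega>)\<^sup>2 + (L t \<omega>)\<^sup>2)"
    by simp
qed

lemma increment_sq_integrable:
  assumes "0 \<le> s" "s < T" "0 \<le> t" "t < T" "A \<in> sets M"
  shows "integrable M (\<lambda>\<omega>. indicator A \<omega> * (L t \<omega> - L s \<omega>)\<^sup>2)"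
proof -
  have "(\<lambda>\<omega>. (L t \<omega> - L s \<omega>)\<^sup>2) = (\<lambda>\<omega>. (L t \<omega>)\<^sup>2 + (L s \<omega>)\<^sup>2 - 2 * (L t \<omega> * L s \<omega>))"
    by (auto simp: power2_eq_square algebra_simps)
  then have "integrable M (\<lambda>\<omega>. (L t \<omega> - L s \<omega>)\<^sup>2)"
    using assms by (auto intro!: L_square L_product_integrable)
  from integrable_mult_indicator[OF assms(5) this] show ?thesis
    by simp
qed

text \<open>The submartingale property of squared increments, tested on an event of
  \<open>F r\<close>. Right side minus left side is the integral of
  \<open>(L u \<omega> - L r \<omega>)\<^sup>2\<close> over \<open>A\<close>, because the cross term
  vanishes.\<close>

lemma increment_sq_mono:
  assumes "0 \<le> s" "s \<le> r" "r \<le> u" "u < T" and A: "A \<in> sets (F r)"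
  shows "(\<integral>\<omega>. indicator A \<omega> * (L r \<omega> - L s \<omega>)\<^sup>2 \<partial>M) \<le> (\<integral>\<omega>. indicator A \<omega> * (L u \<omega> - L s \<omega>)\<^sup>2 \<partial>M)"
proof -
  interpret R: sigma_finite_subalgebra M "F r" by (rule sigma_finite_F)
  have AM: "A \<in> sets M"
    using A subalgebra_F[of r] by (auto simp: subalgebra_def)
  note [measurable] = L_measurable[of u] L_measurable[of r]
  \<comment> \<open>\<open>X\<close> is measurable for \<open>F r\<close>, so the martingale
    property allows \<open>L u\<close> to be replaced by \<open>L r\<close> in integrals against
    \<open>X\<close>.\<close>
  define X where "X \<omega> = indicator A \<omega> * (L r \<omega> - L s \<omega>)" for \<omega>
  have X: "X \<in> borel_measurable (F r)"
    using A L_F_measurable[of r r] L_F_measurable[of s r] assms unfolding X_def by simp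
  have int: "integrable M (\<lambda>\<omega>. X \<omega> * L v \<omega>)" if "0 \<le> v" "v < T" for v
  proof -
    have "integrable M (\<lambda>\<omega>. L r \<omega> * L v \<omega> - L s \<omega> * L v \<omega>)"
      using assms that by (intro Bochner_Integration.integrable_diff L_product_integrable) auto
    from integrable_mult_indicator[OF AM this] show ?thesis
      by (simp add: X_def algebra_simps)
  qed
  have "(\<integral>\<omega>. X \<omega> * L u \<omega> \<partial>M) = (\<integral>\<omega>. X \<omega> * real_cond_exp M (F r) (L u) \<omega> \<partial>M)"
    using R.real_cond_exp_intg(2)[OF int[of u] X] assms by simp
  also have "\<dots> = (\<integral>\<omega>. X \<omega> * L r \<omega> \<partial>M)"
    using L_cond_exp[of r u] assms measurable_from_subalg[OF subalgebra_F X]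
    by (intro integral_cong_AE) auto
  finally have eq: "(\<integral>\<omega>. X \<omega> * L u \<omega> \<partial>M) = (\<integral>\<omega>. X \<omega> * L r \<omega> \<partial>M)" .
  have "0 \<le> (\<integral>\<omega>. indicator A \<omega> * (L u \<omega> - L r \<omega>)\<^sup>2 \<partial>M)"
    by (intro integral_nonneg_AE) auto
  also have "\<dots> = (\<integral>\<omega>. indicator A \<omega> * (L u \<omega> - L s \<omega>)\<^sup>2 - indicator A \<omega> * (L r \<omega> - L s \<omega>)\<^sup>2
      - 2 * (X \<omega> * L u \<omega> - X \<omega> * L r \<omega>) \<partial>M)"
    by (intro Bochner_Integration.integral_cong)
      (auto simp: X_def indicator_def power2_eq_square algebra_simps)
  also have "\<dots> = (\<integral>\<omega>. indicator A \<omega> * (L u \<omega> - L s \<omega>)\<^sup>2 \<partial>M) - (\<integral>\<omega>. indicator A \<omega> * (L r \<omega> - L s \<omega>)\<^sup>2 \<partial>M)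
      - 2 * ((\<integral>\<omega>. X \<omega> * L u \<omega> \<partial>M) - (\<integral>\<omega>. X \<omega> * L r \<omega> \<partial>M))"
    using assms AM int increment_sq_integrable by simp
  finally show ?thesis
    unfolding eq by simp
qed

text \<open>Given \<open>F r\<close>, the conditional expectation of \<open>L t - L s\<close> is
  \<open>L r - L s\<close>, and conditioning preserves constant bounds from both sides.\<close>

lemma increment_bound_backward:
  assumes "0 \<le> s" "s \<le> r" "r \<le> t" "t < T" and bound: "AE \<omega> in M. \<bar>L t \<omega> - L s \<omega>\<bar> \<le> K"
  shows "AE \<omega> in M. \<bar>L r \<omega> - L s \<omega>\<bar> \<le> K"
proof -
  interpret R: sigma_finite_subalgebra M "F r" by (rule sigma_finite_F)
  have Ls: "AE \<omega> in M. real_cond_exp M (F r) (L s) \<omega> = L s \<omega>"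
    using L_integrable[of s] L_F_measurable[of s r] assms by (intro R.real_cond_exp_F_meas) auto
  have i: "integrable M (\<lambda>\<omega>. L t \<omega> - L s \<omega>)"
    using L_integrable assms by auto
  have "AE \<omega> in M. real_cond_exp M (F r) (\<lambda>\<omega>. L t \<omega> - L s \<omega>) \<omega>
      = real_cond_exp M (F r) (L t) \<omega> - real_cond_exp M (F r) (L s) \<omega>"
    using L_integrable assms by (intro R.real_cond_exp_diff) auto
  moreover have "AE \<omega> in M. real_cond_exp M (F r) (\<lambda>\<omega>. L t \<omega> - L s \<omega>) \<omega> \<le> K"
    by (rule R.real_cond_exp_le_c[OF i]) (use bound in auto)
  moreover have "AE \<omega> in M. real_cond_exp M (F r) (\<lambda>\<omega>. L t \<omega> - L s \<omega>) \<omega> \<ge> - K"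
    by (rule R.real_cond_exp_ge_c[OF i]) (use bound in auto)
  ultimately show ?thesis
    using Ls L_cond_exp[of r t] assms by auto
qed

text \<open>One null set has to serve all times: countability settles the rational times, and right
  continuity carries the bound to every \<open>u < t\<close>.\<close>

lemma path_increment_bound:
  assumes "0 \<le> r" "r < t" "t < T" and bound: "AE \<omega> in M. \<bar>L t \<omega> - L r \<omega>\<bar> \<le> K"
  shows "AE \<omega> in M. \<forall>u\<in>{r..t}. \<bar>L u \<omega> - L r \<omega>\<bar> \<le> K"
proof -
  have "AE \<omega> in M. \<forall>q\<in>\<rat> \<inter> {r..t}. \<bar>L q \<omega> - L r \<omega>\<bar> \<le> K"
  proof (subst AE_ball_countable)
    show "countable (\<rat> \<inter> {r..t})"
      by (intro countable_Int1 countable_rat)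
    show "\<forall>q\<in>\<rat> \<inter> {r..t}. AE \<omega> in M. \<bar>L q \<omega> - L r \<omega>\<bar> \<le> K"
    proof
      fix q assume "q \<in> \<rat> \<inter> {r..t}"
      then show "AE \<omega> in M. \<bar>L q \<omega> - L r \<omega>\<bar> \<le> K"
        by (intro increment_bound_backward[OF _ _ _ _ bound]) (use assms in auto)
    qed
  qed
  with bound show ?thesis
    using AE_space
  proof eventually_elim
    case (elim \<omega>)
    show ?case
    proof
      fix u assume u: "u \<in> {r..t}"
      show "\<bar>L u \<omega> - L r \<omega>\<bar> \<le> K"
      \<comment> \<open>Right limits at \<open>t\<close> would involve later times, where no bound
        is known; at \<open>t\<close> the hypothesis applies directly.\<close>
      proof (cases "u = t")
        case False
        then have u': "u < t" using u by simp
        have lim: "((\<lambda>s. L s \<omega>) \<longlongrightarrow> L u \<omega>) (at_right u)"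
          using L_cadlag elim(3) u u' assms by (auto simp: cadlag_def)
        have "\<not> K < \<bar>L u \<omega> - L r \<omega>\<bar>"
        proof
          assume "K < \<bar>L u \<omega> - L r \<omega>\<bar>"
          then have "eventually (\<lambda>s. K < \<bar>L s \<omega> - L r \<omega>\<bar>) (at_right u)"
            using lim by (intro order_tendstoD(1)[where y="\<bar>L u \<omega> - L r \<omega>\<bar>"] tendsto_intros)
          then obtain b where b: "u < b" "\<And>s. u < s \<Longrightarrow> s < b \<Longrightarrow> K < \<bar>L s \<omega> - L r \<omega>\<bar>"
            unfolding eventually_at_right_field by blast
          obtain q where q: "q \<in> \<rat>" "u < q" "q < min b t"
            using Rats_dense_in_real[of u "min b t"] b u' by auto
          then show False
            using b(2)[of q] elim(2) u by force
        qed
        then show ?thesis by simp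
      qed (use elim in simp)
    qed
  qed
qed

section \<open>The BMO norm expressed through increments of the error\<close>

lemma pre_sigma_sigma_finite:
  assumes "stopping_time F \<rho>" "\<And>\<omega>. \<omega> \<in> space M \<Longrightarrow> \<rho> \<omega> \<le> T"
  shows "sigma_finite_subalgebra M (pre_sigma \<rho>)"
  using subalgebra_pre_sigma[OF assms] finite_measure_axioms
  by (intro finite_measure_subalgebra_is_sigma_finite finite_measure_subalgebra.intro
      finite_measure_subalgebra_axioms.intro) auto

lemma stopping_time_measurable:
  "stopping_time F \<rho> \<Longrightarrow> \<rho> \<in> borel_measurable M"
  using subalgebra_F by (intro measurable_stopping_time[of F]) (auto simp: subalgebra_def)

text \<open>The constants admissible in the BMO norm, with absolute value and left limit replaced by
  the integral over \<open>(\<rho>, a]\<close>.\<close>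

definition BMO1_bound :: "real list \<Rightarrow> real \<Rightarrow> bool" where
  "BMO1_bound \<tau> c \<longleftrightarrow> (\<forall>a \<rho>. 0 \<le> a \<and> a < T \<and> stopping_time F \<rho> \<and> (\<forall>\<omega>\<in>space M. \<rho> \<omega> \<in> {0..a}) \<longrightarrow>
     (AE \<omega> in M. nn_cond_exp M (pre_sigma \<rho>) (\<lambda>\<omega>. ennreal (err_incr \<tau> (\<rho> \<omega>) a \<omega>)) \<omega> \<le> ennreal c))"

text \<open>The raw increment contains a left limit at a random time; its measurability is inherited
  from \<open>err_incr\<close>, with which it agrees on \<open>space M\<close>.\<close>

lemma increment_measurable:
  assumes \<tau>: "\<tau> \<in> time_nets T" and "0 \<le> a" "a < T" "stopping_time F \<rho>" "\<forall>\<omega>\<in>space M. \<rho> \<omega> \<in> {0..a}"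
  shows "(\<lambda>\<omega>. ennreal \<bar>approx_error L \<tau> a \<omega> - left_limit (approx_error L \<tau>) (\<rho> \<omega>) \<omega>\<bar>) \<in> borel_measurable M"
    and "(\<lambda>\<omega>. ennreal (err_incr \<tau> (\<rho> \<omega>) a \<omega>)) \<in> borel_measurable M"
proof -
  show *: "(\<lambda>\<omega>. ennreal (err_incr \<tau> (\<rho> \<omega>) a \<omega>)) \<in> borel_measurable M"
    using err_incr_measurable[OF stopping_time_measurable[OF assms(4)]] by simp
  show "(\<lambda>\<omega>. ennreal \<bar>approx_error L \<tau> a \<omega> - left_limit (approx_error L \<tau>) (\<rho> \<omega>) \<omega>\<bar>) \<in> borel_measurable M"
    by (rule measurable_cong[THEN iffD1, OF _ *]) (use approx_error_increment[OF \<tau>] assms in auto)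
qed

lemma BMO1_norm_eq:
  assumes \<tau>: "\<tau> \<in> time_nets T"
  shows "BMO1_norm M F T (approx_error L \<tau>) = Inf (ennreal ` {c. 0 \<le> c \<and> BMO1_bound \<tau> c})"
proof -
  have "(AE \<omega> in M. nn_cond_exp M (pre_sigma \<rho>)
          (\<lambda>\<omega>. ennreal \<bar>approx_error L \<tau> a \<omega> - left_limit (approx_error L \<tau>) (\<rho> \<omega>) \<omega>\<bar>) \<omega> \<le> ennreal c) \<longleftrightarrow>
        (AE \<omega> in M. nn_cond_exp M (pre_sigma \<rho>) (\<lambda>\<omega>. ennreal (err_incr \<tau> (\<rho> \<omega>) a \<omega>)) \<omega> \<le> ennreal c)"
    if *: "0 \<le> a" "a < T" "stopping_time F \<rho>" "\<forall>\<omega>\<in>space M. \<rho> \<omega> \<in> {0..a}" for a \<rho> c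
  proof -
    interpret R: sigma_finite_subalgebra M "pre_sigma \<rho>"
      using * by (intro pre_sigma_sigma_finite) force+
    have "AE \<omega> in M. nn_cond_exp M (pre_sigma \<rho>)
          (\<lambda>\<omega>. ennreal \<bar>approx_error L \<tau> a \<omega> - left_limit (approx_error L \<tau>) (\<rho> \<omega>) \<omega>\<bar>) \<omega>
        = nn_cond_exp M (pre_sigma \<rho>) (\<lambda>\<omega>. ennreal (err_incr \<tau> (\<rho> \<omega>) a \<omega>)) \<omega>"
      using approx_error_increment[OF \<tau>] * increment_measurable[OF \<tau> *]
      by (intro R.nn_cond_exp_cong AE_I2) auto
    then have "AE \<omega> in M. (nn_cond_exp M (pre_sigma \<rho>)
          (\<lambda>\<omega>. ennreal \<bar>approx_error L \<tau> a \<omega> - left_limit (approx_error L \<tau>) (\<rho> \<omega>) \<omega>\<bar>) \<omega> \<le> ennreal c)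
        = (nn_cond_exp M (pre_sigma \<rho>) (\<lambda>\<omega>. ennreal (err_incr \<tau> (\<rho> \<omega>) a \<omega>)) \<omega> \<le> ennreal c)"
      by eventually_elim simp
    then show ?thesis
      by (rule eventually_subst)
  qed
  then have "(\<forall>a\<in>{0..<T}. \<forall>\<rho>. stopping_time F \<rho> \<and> (\<forall>\<omega>\<in>space M. \<rho> \<omega> \<in> {0..a}) \<longrightarrow>
        (AE \<omega> in M. nn_cond_exp M (pre_sigma \<rho>)
          (\<lambda>\<omega>. ennreal \<bar>approx_error L \<tau> a \<omega> - left_limit (approx_error L \<tau>) (\<rho> \<omega>) \<omega>\<bar>) \<omega> \<le> ennreal c))
      \<longleftrightarrow> BMO1_bound \<tau> c" for c
    unfolding BMO1_bound_def by (meson atLeastLessThan_iff)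
  then show ?thesis
    unfolding BMO1_norm_def by simp
qed

section \<open>Lower and upper estimates for the BMO constants\<close>

lemma err_incr_nn_integral:
  assumes "\<omega> \<in> space M" "0 \<le> b" "a < T"
  shows "ennreal (err_incr \<tau> b a \<omega>) = (\<integral>\<^sup>+u. ennreal (indicator {b<..a} u * sq_err \<tau> u \<omega>) \<partial>lborel)"
  unfolding err_incr_def using assms
  by (intro nn_integral_eq_integral[symmetric] sq_err_integrable[where b=b and a=a]) (auto simp: sq_err_nonneg)

lemma sq_err_eq:
  assumes "\<tau> \<in> time_nets T" "0 < u" "u < T"
  shows "sq_err \<tau> u \<omega> = (L u \<omega> - L (net_left \<tau> u) \<omega>)\<^sup>2"
proof -
  obtain j where "j < length \<tau>" "\<tau> ! j = net_left \<tau> u" "net_left \<tau> u < u"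
    using net_left_mem[OF assms(1) T_pos assms(2)] by (auto simp: in_set_conv_nth)
  then have "0 \<le> net_left \<tau> u" "net_left \<tau> u < u"
    using time_netsD(6)[OF assms(1) T_pos, of j] by auto
  then show ?thesis
    using net_step_eq[OF assms(1) T_pos assms(2), of "\<lambda>p. L0 p \<omega>"] assms
    unfolding sq_err_def by (simp add: L0_def)
qed

text \<open>The constant stopping time \<open>r\<close> is tested on the event \<open>A\<close> that
  the increment from the left end to \<open>r\<close> exceeds \<open>m\<close>. The integral over
  \<open>A\<close> of the error on \<open>(r,a]\<close> is at least
  \<open>(a - r) * m\<^sup>2\<close> and at most \<open>c\<close> times the probability of
  \<open>A\<close>, which is positive and cancels.\<close>

lemma BMO1_bound_ge:
  assumes \<tau>: "\<tau> \<in> time_nets T" and i: "i \<in> {1..<length \<tau>}"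
    and r: "\<tau> ! (i - 1) < r" "r < a" "a \<le> \<tau> ! i" "a < T"
    and c: "0 \<le> c" "BMO1_bound \<tau> c"
    and m: "0 \<le> m" "\<not> (AE \<omega> in M. \<bar>L r \<omega> - L (\<tau> ! (i - 1)) \<omega>\<bar> \<le> m)"
  shows "(a - r) * m\<^sup>2 \<le> c"
proof -
  define s where "s = \<tau> ! (i - 1)"
  have s: "0 \<le> s" "s < r"
    using time_netsD(6)[OF \<tau> T_pos, of "i - 1"] i r unfolding s_def by auto
  note [measurable] = L_measurable[of r] L_measurable[of s]
  let ?G = "pre_sigma (\<lambda>_. r)"
  interpret R: sigma_finite_subalgebra M ?G
    using r by (intro pre_sigma_sigma_finite stopping_time_const) auto
  define A where "A = {\<omega> \<in> space M. m < \<bar>L r \<omega> - L s \<omega>\<bar>}"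
  have AF: "A \<in> sets (F r)"
  proof -
    have [measurable]: "L r \<in> borel_measurable (F r)" "L s \<in> borel_measurable (F r)"
      using L_F_measurable s r by auto
    have "{\<omega> \<in> space (F r). m < \<bar>L r \<omega> - L s \<omega>\<bar>} \<in> sets (F r)"
      by measurable
    then show ?thesis
      by (simp add: A_def space_F)
  qed
  then have A [measurable]: "A \<in> sets M"
    using subalgebra_F[of r] by (auto simp: subalgebra_def)
  have AG: "A \<in> sets ?G"
  proof (intro sets_pre_sigmaI stopping_time_const)
    show "{\<omega> \<in> A. r \<le> t} \<in> sets (F t)" for t
      using AF sets_F_mono[of r t] by (cases "r \<le> t") auto
  qed
  have pos: "0 < measure M A"
  proof (rule ccontr)
    assume "\<not> 0 < measure M A"
    then have "A \<in> null_sets M"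
      using A by (simp add: null_sets_def emeasure_eq_measure zero_less_measure_iff)
    then have "AE \<omega> in M. \<bar>L r \<omega> - L s \<omega>\<bar> \<le> m"
      by (rule AE_I') (auto simp: A_def)
    then show False
      using m(2) by (simp add: s_def)
  qed
  \<comment> \<open>Up to time \<open>a\<close> the left end in use is still \<open>s\<close>, so
    \<open>increment_sq_mono\<close> transports the lower bound from time \<open>r\<close> to time
    \<open>u\<close>.\<close>
  have low: "ennreal (m\<^sup>2 * measure M A) \<le> (\<integral>\<^sup>+\<omega>. indicator A \<omega> * ennreal (sq_err \<tau> u \<omega>) \<partial>M)"
    if u: "r < u" "u \<le> a" for u
  proof -
    have "m\<^sup>2 * measure M A = (\<integral>\<omega>. indicator A \<omega> * m\<^sup>2 \<partial>M)"
      by simp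
    also have "\<dots> \<le> (\<integral>\<omega>. indicator A \<omega> * (L r \<omega> - L s \<omega>)\<^sup>2 \<partial>M)"
    proof (intro integral_mono increment_sq_integrable integrable_mult_left)
      show "integrable M (indicator A :: 'a \<Rightarrow> real)"
        using A by (intro integrable_real_indicator) (auto simp: emeasure_eq_measure)
      show "indicator A \<omega> * m\<^sup>2 \<le> indicator A \<omega> * (L r \<omega> - L s \<omega>)\<^sup>2" for \<omega>
        using m(1) abs_le_square_iff[of m "L r \<omega> - L s \<omega>"] by (auto simp: A_def indicator_def)
    qed (use s r A in auto)
    also have "\<dots> \<le> (\<integral>\<omega>. indicator A \<omega> * (L u \<omega> - L s \<omega>)\<^sup>2 \<partial>M)"
      using s r u AF by (intro increment_sq_mono) auto
    finally have "ennreal (m\<^sup>2 * measure M A) \<le> ennreal (\<integral>\<omega>. indicator A \<omega> * (L u \<omega> - L s \<omega>)\<^sup>2 \<partial>M)"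
      by (rule ennreal_leI)
    also have "\<dots> = (\<integral>\<^sup>+\<omega>. ennreal (indicator A \<omega> * (L u \<omega> - L s \<omega>)\<^sup>2) \<partial>M)"
      using s r u A by (intro nn_integral_eq_integral[symmetric] increment_sq_integrable) auto
    also have "\<dots> = (\<integral>\<^sup>+\<omega>. indicator A \<omega> * ennreal (sq_err \<tau> u \<omega>) \<partial>M)"
    proof (intro nn_integral_cong)
      have "net_left \<tau> u = s"
        unfolding s_def using i u r by (intro net_leftI[OF \<tau> T_pos]) auto
      then show "ennreal (indicator A \<omega> * (L u \<omega> - L s \<omega>)\<^sup>2) = indicator A \<omega> * ennreal (sq_err \<tau> u \<omega>)" for \<omega>
        using sq_err_eq[OF \<tau>, of u \<omega>] s r u by (simp add: indicator_def)
    qed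
    finally show ?thesis .
  qed
  have "ennreal ((a - r) * m\<^sup>2 * measure M A) = (\<integral>\<^sup>+u. indicator {r<..a} u * ennreal (m\<^sup>2 * measure M A) \<partial>lborel)"
    using r by (simp add: nn_integral_multc ennreal_mult mult.assoc)
  also have "\<dots> \<le> (\<integral>\<^sup>+u. \<integral>\<^sup>+\<omega>. indicator A \<omega> * ennreal (indicator {r<..a} u * sq_err \<tau> u \<omega>) \<partial>M \<partial>lborel)"
    using low by (intro nn_integral_mono) (auto simp: indicator_def)
  also have "\<dots> = (\<integral>\<^sup>+\<omega>. \<integral>\<^sup>+u. indicator A \<omega> * ennreal (indicator {r<..a} u * sq_err \<tau> u \<omega>) \<partial>lborel \<partial>M)"
  proof -
    interpret P: pair_sigma_finite lborel M ..
    have [measurable]: "(\<lambda>x. sq_err \<tau> (fst x) (snd x)) \<in> borel_measurable (lborel \<Otimes>\<^sub>M M)"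
      using sq_err_joint_measurable by simp
    show ?thesis
      by (rule P.Fubini'[symmetric]) (simp add: case_prod_beta)
  qed
  also have "\<dots> = (\<integral>\<^sup>+\<omega>. indicator A \<omega> * ennreal (err_incr \<tau> r a \<omega>) \<partial>M)"
    using err_incr_nn_integral[of _ r a \<tau>] s r
    by (intro nn_integral_cong) (auto simp: indicator_def)
  \<comment> \<open>\<open>A\<close> belongs to the sigma-algebra of the constant time
    \<open>r\<close>, so the conditional expectation may be inserted under the integral.\<close>
  also have "\<dots> = (\<integral>\<^sup>+\<omega>. indicator A \<omega> * nn_cond_exp M ?G (\<lambda>\<omega>. ennreal (err_incr \<tau> r a \<omega>)) \<omega> \<partial>M)"
    using AG err_incr_measurable[of "\<lambda>_. r" \<tau> a] by (intro R.nn_cond_exp_intg[symmetric]) auto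
  also have "\<dots> \<le> (\<integral>\<^sup>+\<omega>. indicator A \<omega> * ennreal c \<partial>M)"
  proof (intro nn_integral_mono_AE)
    have "AE \<omega> in M. nn_cond_exp M ?G (\<lambda>\<omega>. ennreal (err_incr \<tau> r a \<omega>)) \<omega> \<le> ennreal c"
      using c(2) s r stopping_time_const[of F r] unfolding BMO1_bound_def by auto
    then show "AE \<omega> in M. indicator A \<omega> * nn_cond_exp M ?G (\<lambda>\<omega>. ennreal (err_incr \<tau> r a \<omega>)) \<omega>
        \<le> indicator A \<omega> * ennreal c"
      by eventually_elim (auto simp: indicator_def)
  qed
  also have "\<dots> = ennreal (c * measure M A)"
    using c(1) nn_integral_cmult_indicator[OF A, of "ennreal c"]
    by (simp add: emeasure_eq_measure ennreal_mult mult.commute[of "indicator _ _"])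
  finally have "(a - r) * m\<^sup>2 * measure M A \<le> c * measure M A"
    using c(1) by (subst (asm) ennreal_le_iff) simp_all
  then show ?thesis
    using pos by simp
qed

text \<open>The nets can differ in their left ends only for \<open>u\<close> in
  \<open>(r,t]\<close>. There the thinned net has squared error at most \<open>K\<^sup>2\<close>, a
  surplus of at most \<open>(t - r) * K\<^sup>2\<close> whatever the stopping time.\<close>

lemma BMO1_bound_thin:
  assumes \<tau>: "\<tau> \<in> time_nets T" and \<tau>': "\<tau>' \<in> time_nets T"
    and rt: "0 \<le> r" "r < t" "t < T"
    and thin: "set \<tau> = set \<tau>' - {r<..<t}" "r \<in> set \<tau>" "t \<in> set \<tau>"
    and c: "0 \<le> c" "BMO1_bound \<tau>' c"
    and bound: "AE \<omega> in M. \<bar>L t \<omega> - L r \<omega>\<bar> \<le> K"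
  shows "BMO1_bound \<tau> (c + (t - r) * K\<^sup>2)"
  unfolding BMO1_bound_def
proof (intro allI impI)
  fix a \<rho> assume "0 \<le> a \<and> a < T \<and> stopping_time F \<rho> \<and> (\<forall>\<omega>\<in>space M. \<rho> \<omega> \<in> {0..a})"
  then have a: "0 \<le> a" "a < T" "stopping_time F \<rho>" "\<forall>\<omega>\<in>space M. \<rho> \<omega> \<in> {0..a}"
    by auto
  interpret R: sigma_finite_subalgebra M "pre_sigma \<rho>"
    using a by (intro pre_sigma_sigma_finite) force+
  let ?k = "ennreal ((t - r) * K\<^sup>2)"
  have "AE \<omega> in M. ennreal (err_incr \<tau> (\<rho> \<omega>) a \<omega>) \<le> ennreal (err_incr \<tau>' (\<rho> \<omega>) a \<omega>) + ?k"
    using path_increment_bound[OF rt bound] AE_space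
  proof eventually_elim
    case (elim \<omega>)
    have \<rho>: "0 \<le> \<rho> \<omega>" "\<rho> \<omega> \<le> a"
      using a(4) elim(2) by auto
    have pt: "indicator {\<rho> \<omega><..a} u * sq_err \<tau> u \<omega>
        \<le> indicator {\<rho> \<omega><..a} u * sq_err \<tau>' u \<omega> + indicator {r<..t} u * K\<^sup>2" for u
    proof (cases "\<rho> \<omega> < u \<and> u \<le> a")
      case True
      then have u: "0 < u" "u < T" using \<rho> a by auto
      show ?thesis
      proof (cases "u \<in> {r<..t}")
        case in': True
        then have "sq_err \<tau> u \<omega> = (L u \<omega> - L r \<omega>)\<^sup>2"
          using sq_err_eq[OF \<tau> u] net_left_thin(2)[OF \<tau> T_pos thin rt(2) u(1)] by simp
        moreover have "\<bar>L u \<omega> - L r \<omega>\<bar> \<le> \<bar>K\<bar>"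
          using bspec[OF elim(1), of u] in' by simp
        then have "(L u \<omega> - L r \<omega>)\<^sup>2 \<le> K\<^sup>2"
          by (rule abs_le_square_iff[THEN iffD1])
        ultimately show ?thesis
          using True in' sq_err_nonneg[of \<tau>' u \<omega>] by simp
      next
        case False
        then show ?thesis
          using True sq_err_eq[OF \<tau> u] sq_err_eq[OF \<tau>' u] net_left_thin(1)[OF \<tau> T_pos thin rt(2) u(1)] by simp
      qed
    qed simp
    have i2: "integrable lborel (\<lambda>u. indicator {r<..t} u * K\<^sup>2)"
      using rt by (intro integrable_mult_left integrable_real_indicator) auto
    have i: "integrable lborel (\<lambda>u. indicator {\<rho> \<omega><..a} u * sq_err \<tau>'' u \<omega>)" for \<tau>''
      using elim \<rho> a by (intro sq_err_integrable[where b="\<rho> \<omega>" and a=a]) auto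
    have "err_incr \<tau> (\<rho> \<omega>) a \<omega> \<le> (\<integral>u. indicator {\<rho> \<omega><..a} u * sq_err \<tau>' u \<omega> + indicator {r<..t} u * K\<^sup>2 \<partial>lborel)"
      unfolding err_incr_def by (intro integral_mono i Bochner_Integration.integrable_add i2 pt)
    also have "\<dots> = err_incr \<tau>' (\<rho> \<omega>) a \<omega> + (t - r) * K\<^sup>2"
      unfolding err_incr_def using rt by (subst Bochner_Integration.integral_add[OF i i2]) simp
    finally show ?case
      using err_incr_nonneg rt by (simp add: ennreal_leI flip: ennreal_plus)
  qed
  then have "AE \<omega> in M. nn_cond_exp M (pre_sigma \<rho>) (\<lambda>\<omega>. ennreal (err_incr \<tau> (\<rho> \<omega>) a \<omega>)) \<omega>
      \<le> nn_cond_exp M (pre_sigma \<rho>) (\<lambda>\<omega>. ennreal (err_incr \<tau>' (\<rho> \<omega>) a \<omega>) + ?k) \<omega>"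
    using increment_measurable(2)[OF \<tau> a] increment_measurable(2)[OF \<tau>' a] by (intro R.nn_cond_exp_mono) auto
  \<comment> \<open>Additivity, together with the value on constants, turns the pathwise surplus
    into the same surplus of the conditional expectations.\<close>
  moreover have "AE \<omega> in M. nn_cond_exp M (pre_sigma \<rho>) (\<lambda>\<omega>. ennreal (err_incr \<tau>' (\<rho> \<omega>) a \<omega>)) \<omega>
      + nn_cond_exp M (pre_sigma \<rho>) (\<lambda>_. ?k) \<omega>
      = nn_cond_exp M (pre_sigma \<rho>) (\<lambda>\<omega>. ennreal (err_incr \<tau>' (\<rho> \<omega>) a \<omega>) + ?k) \<omega>"
    using increment_measurable(2)[OF \<tau>' a] by (intro R.nn_cond_exp_sum) auto
  moreover have "AE \<omega> in M. ?k = nn_cond_exp M (pre_sigma \<rho>) (\<lambda>_. ?k) \<omega>"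
    by (intro R.nn_cond_exp_F_meas) auto
  moreover have "AE \<omega> in M. nn_cond_exp M (pre_sigma \<rho>) (\<lambda>\<omega>. ennreal (err_incr \<tau>' (\<rho> \<omega>) a \<omega>)) \<omega> \<le> ennreal c"
    using c(2) a unfolding BMO1_bound_def by blast
  ultimately show "AE \<omega> in M. nn_cond_exp M (pre_sigma \<rho>) (\<lambda>\<omega>. ennreal (err_incr \<tau> (\<rho> \<omega>) a \<omega>)) \<omega>
      \<le> ennreal (c + (t - r) * K\<^sup>2)"
  proof eventually_elim
    case (elim \<omega>)
    have "nn_cond_exp M (pre_sigma \<rho>) (\<lambda>\<omega>. ennreal (err_incr \<tau> (\<rho> \<omega>) a \<omega>)) \<omega> \<le> ennreal c + ?k"
      using elim(1) add_right_mono[OF elim(4), of ?k]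
      unfolding elim(2)[symmetric] elim(3)[symmetric] by (rule order.trans)
    then show ?case
      using c(1) rt by (simp add: ennreal_plus)
  qed
qed

subsection \<open>Oscillation and mesh size\<close>

lemma BMO1_norm_ge_mesh:
  assumes \<theta>: "\<theta> \<le> 1"
    and osc: "0 < (INF t\<in>{0<..<T}. ennreal ((T - t) powr ((1 - \<theta>) / 2)) * lower_osc M L t)"
  shows "\<exists>c>0. \<forall>\<tau>\<in>time_nets T. ennreal (c * mesh T \<theta> \<tau>) \<le> BMO1_norm M F T (approx_error L \<tau>)"
proof -
  \<comment> \<open>The infimum may be infinite, so a finite positive number below it is
    taken.\<close>
  obtain y where y: "0 < y" "y < (INF t\<in>{0<..<T}. ennreal ((T - t) powr ((1 - \<theta>) / 2)) * lower_osc M L t)"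
    using dense[OF osc] by blast
  obtain e where e: "0 < e" "y = ennreal e"
    using y by (cases y) auto
  have "ennreal (e\<^sup>2 / 2 * mesh T \<theta> \<tau>) \<le> BMO1_norm M F T (approx_error L \<tau>)"
    if \<tau>: "\<tau> \<in> time_nets T" for \<tau>
  proof -
    obtain i where i: "i \<in> {1..<length \<tau>}"
      "mesh T \<theta> \<tau> = (\<tau> ! i - \<tau> ! (i - 1)) / (T - \<tau> ! (i - 1)) powr (1 - \<theta>)"
      using mesh_attained[OF \<tau> T_pos] .
    define s where "s = \<tau> ! (i - 1)"
    define d where "d = \<tau> ! i - s"
    \<comment> \<open>Quarter points of an interval attaining the mesh: \<open>r\<close> lies
      strictly after \<open>s\<close>, \<open>a\<close> strictly before \<open>T\<close> even in the
      last interval, and \<open>a - r\<close> is half the length. This half is the 2 in the constant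
      \<open>e\<^sup>2 / 2\<close>.\<close>
    define r where "r = s + d / 4"
    define a where "a = s + 3 / 4 * d"
    define w where "w = (T - r) powr ((1 - \<theta>) / 2)"
    have "i - 1 < i" "i < length \<tau>"
      using i(1) by auto
    then have sd: "0 \<le> s" "0 < d" "s + d \<le> T"
      using time_netsD(5)[OF \<tau> T_pos, of "i - 1" i] time_netsD(6)[OF \<tau> T_pos, of "i - 1"]
        time_netsD(6)[OF \<tau> T_pos, of i] unfolding s_def d_def by auto
    then have r: "s < r" "r < a" "a \<le> \<tau> ! i" "a < T" "0 < r" "r < T"
      using d_def unfolding r_def a_def by linarith+
    \<comment> \<open>As \<open>1 - \<theta>\<close> is nonnegative, the squared weight at
      \<open>r\<close> is at most the denominator that the mesh has at \<open>s\<close>.\<close>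
    have w: "0 < w" "w\<^sup>2 \<le> (T - s) powr (1 - \<theta>)"
    proof -
      show "0 < w"
        unfolding w_def using r by simp
      have "w\<^sup>2 = (T - r) powr (1 - \<theta>)"
        unfolding w_def using r by (simp add: power2_eq_square flip: powr_add)
      also have "\<dots> \<le> (T - s) powr (1 - \<theta>)"
        using r \<theta> by (intro powr_mono2) auto
      finally show "w\<^sup>2 \<le> (T - s) powr (1 - \<theta>)" .
    qed
    \<comment> \<open>\<open>s\<close> competes in the infimum defining the oscillation at
      \<open>r\<close>, so a bound by \<open>e / w\<close> would push the weighted oscillation at
      \<open>r\<close> down to \<open>e\<close>, below the infimum over all times.\<close>
    have not_AE: "\<not> (AE \<omega> in M. \<bar>L r \<omega> - L s \<omega>\<bar> \<le> e / w)"
    proof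
      assume "AE \<omega> in M. \<bar>L r \<omega> - L s \<omega>\<bar> \<le> e / w"
      then have "AE \<omega> in M. ennreal \<bar>L r \<omega> - L s \<omega>\<bar> \<le> ennreal (e / w)"
        by eventually_elim (rule ennreal_leI)
      then have "esssup M (\<lambda>\<omega>. ennreal \<bar>L r \<omega> - L s \<omega>\<bar>) \<le> ennreal (e / w)"
        using L_measurable[of r] L_measurable[of s] sd r by (intro esssup_I) auto
      then have "lower_osc M L r \<le> ennreal (e / w)"
        unfolding lower_osc_def using sd r by (intro INF_lower2[of s]) auto
      then have "ennreal w * lower_osc M L r \<le> ennreal w * ennreal (e / w)"
        by (rule mult_left_mono) simp
      also have "\<dots> = ennreal e"
        using w e by (simp flip: ennreal_mult)
      finally have "ennreal w * lower_osc M L r \<le> y"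
        using e by simp
      moreover have "(INF t\<in>{0<..<T}. ennreal ((T - t) powr ((1 - \<theta>) / 2)) * lower_osc M L t)
          \<le> ennreal w * lower_osc M L r"
        unfolding w_def using r by (intro INF_lower) auto
      ultimately show False
        using y(2) by simp
    qed
    have "e\<^sup>2 / 2 * mesh T \<theta> \<tau> \<le> c" if c: "0 \<le> c" "BMO1_bound \<tau> c" for c
    proof -
      have "(a - r) * (e / w)\<^sup>2 \<le> c"
        using not_AE r w e c unfolding s_def by (intro BMO1_bound_ge[OF \<tau> i(1)]) auto
      moreover have "e\<^sup>2 / 2 * mesh T \<theta> \<tau> \<le> (a - r) * (e / w)\<^sup>2"
      proof -
        have "e\<^sup>2 / 2 * mesh T \<theta> \<tau> = d / 2 * e\<^sup>2 / (T - s) powr (1 - \<theta>)"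
          unfolding i(2) d_def s_def by simp
        also have "\<dots> \<le> d / 2 * e\<^sup>2 / w\<^sup>2"
          using w sd by (intro divide_left_mono) auto
        also have "d / 2 = a - r"
          unfolding a_def r_def by simp
        finally show ?thesis
          by (simp add: power_divide)
      qed
      ultimately show ?thesis by simp
    qed
    then show ?thesis
      unfolding BMO1_norm_eq[OF \<tau>] by (intro Inf_greatest) (auto intro: ennreal_leI)
  qed
  then show ?thesis
    using e(1) by (intro exI[of _ "e\<^sup>2 / 2"]) auto
qed

text \<open>The assumed lower bound meets \<open>BMO1_bound_thin\<close> on the thinned net. Both
  main terms are proportional to \<open>t - r\<close>, so this length cancels once the contribution
  \<open>\<epsilon>\<close> of the fine net has been removed.\<close>

lemma increment_bound_ge:
  assumes "c > 0"
    and ge: "\<And>\<tau>. \<tau> \<in> time_nets T \<Longrightarrow> ennreal (c * mesh T \<theta> \<tau>) \<le> BMO1_norm M F T (approx_error L \<tau>)"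
    and small: "\<forall>\<epsilon>>0. \<exists>\<delta>>0. \<forall>\<tau>\<in>time_nets T. mesh T 1 \<tau> < \<delta> \<longrightarrow>
           BMO1_norm M F T (approx_error L \<tau>) < ennreal \<epsilon>"
    and rt: "0 \<le> r" "r < t" "t < T"
    and bound: "AE \<omega> in M. \<bar>L t \<omega> - L r \<omega>\<bar> \<le> K"
  shows "c / (T - r) powr (1 - \<theta>) \<le> K\<^sup>2"
proof -
  have "c * ((t - r) / (T - r) powr (1 - \<theta>)) \<le> (t - r) * K\<^sup>2 + \<epsilon>" if \<epsilon>: "0 < \<epsilon>" for \<epsilon>
  proof -
    obtain \<delta> where \<delta>: "0 < \<delta>" "\<forall>\<tau>\<in>time_nets T. mesh T 1 \<tau> < \<delta> \<longrightarrow>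
        BMO1_norm M F T (approx_error L \<tau>) < ennreal \<epsilon>"
      using small \<epsilon> by blast
    obtain \<tau> \<tau>' where \<tau>: "\<tau> \<in> time_nets T" and \<tau>': "\<tau>' \<in> time_nets T" "mesh T 1 \<tau>' < \<delta>"
      and thin: "set \<tau> = set \<tau>' - {r<..<t}" "r \<in> set \<tau>" "t \<in> set \<tau>"
      and mesh: "\<And>\<theta>. (t - r) / (T - r) powr (1 - \<theta>) \<le> mesh T \<theta> \<tau>"
      using fine_time_nets[OF T_pos rt \<delta>(1)] by metis
    have "Inf (ennreal ` {c. 0 \<le> c \<and> BMO1_bound \<tau>' c}) < ennreal \<epsilon>"
      using \<delta>(2) \<tau>' by (simp flip: BMO1_norm_eq)
    \<comment> \<open>The norm is an infimum, so some admissible constant of the fine net is below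
      \<open>\<epsilon>\<close>.\<close>
    then obtain b where b: "0 \<le> b" "BMO1_bound \<tau>' b" "b < \<epsilon>"
      unfolding Inf_less_iff by (auto simp: ennreal_less_iff)
    have nonneg: "0 \<le> (t - r) * K\<^sup>2"
      using rt by simp
    have "BMO1_bound \<tau> (b + (t - r) * K\<^sup>2)"
      using BMO1_bound_thin[OF \<tau> \<tau>'(1) rt thin b(1,2) bound] .
    then have "BMO1_norm M F T (approx_error L \<tau>) \<le> ennreal (b + (t - r) * K\<^sup>2)"
      unfolding BMO1_norm_eq[OF \<tau>] using b(1) nonneg by (intro Inf_lower imageI) auto
    then have "ennreal (c * mesh T \<theta> \<tau>) \<le> ennreal (b + (t - r) * K\<^sup>2)"
      using ge[OF \<tau>] by (rule order.trans[rotated])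
    then have "c * mesh T \<theta> \<tau> \<le> b + (t - r) * K\<^sup>2"
      using b(1) nonneg by (subst (asm) ennreal_le_iff) auto
    moreover have "c * ((t - r) / (T - r) powr (1 - \<theta>)) \<le> c * mesh T \<theta> \<tau>"
      using mesh \<open>c > 0\<close> by (intro mult_left_mono) auto
    ultimately show ?thesis
      using b(3) by linarith
  qed
  then have "c * ((t - r) / (T - r) powr (1 - \<theta>)) \<le> (t - r) * K\<^sup>2"
    by (rule field_le_epsilon)
  then have "(t - r) * (c / (T - r) powr (1 - \<theta>)) \<le> (t - r) * K\<^sup>2"
    by (simp add: mult.commute)
  then show ?thesis
    by (rule mult_left_le_imp_le) (use rt in simp)
qed

lemma lower_osc_pos:
  assumes \<theta>: "0 \<le> \<theta>" "\<theta> \<le> 1" and c: "c > 0"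
    and ge: "\<And>\<tau>. \<tau> \<in> time_nets T \<Longrightarrow> ennreal (c * mesh T \<theta> \<tau>) \<le> BMO1_norm M F T (approx_error L \<tau>)"
    and small: "\<forall>\<epsilon>>0. \<exists>\<delta>>0. \<forall>\<tau>\<in>time_nets T. mesh T 1 \<tau> < \<delta> \<longrightarrow>
           BMO1_norm M F T (approx_error L \<tau>) < ennreal \<epsilon>"
  shows "0 < (INF t\<in>{0<..<T}. ennreal ((T - t) powr ((1 - \<theta>) / 2)) * lower_osc M L t)"
proof -
  \<comment> \<open>The 8 is 4 times 2: splitting the increment doubles \<open>K\<close>, which is
    then squared, and passing from \<open>T - r\<close> to \<open>T - t\<close> costs at most
    \<open>2 powr (1 - \<theta>) \<le> 2\<close>.\<close>
  define k where "k = sqrt (c / 8)"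
  have k: "0 < k" "k\<^sup>2 = c / 8"
    unfolding k_def using c by auto
  have "ennreal k \<le> ennreal ((T - t) powr ((1 - \<theta>) / 2)) * lower_osc M L t" if t: "t \<in> {0<..<T}" for t
  proof -
    define w where "w = (T - t) powr ((1 - \<theta>) / 2)"
    have w: "0 < w" "w\<^sup>2 = (T - t) powr (1 - \<theta>)"
      unfolding w_def using t by (simp_all add: power2_eq_square flip: powr_add)
    have "ennreal (k / w) \<le> esssup M (\<lambda>\<omega>. ennreal \<bar>L t \<omega> - L s \<omega>\<bar>)" if s: "s \<in> {0..<t}" for s
    proof (rule ccontr)
      assume less: "\<not> ennreal (k / w) \<le> esssup M (\<lambda>\<omega>. ennreal \<bar>L t \<omega> - L s \<omega>\<bar>)"
      \<comment> \<open>Being below \<open>k / w\<close>, the essential supremum is finite and hence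
        a real number.\<close>
      then obtain K where K: "0 \<le> K" "esssup M (\<lambda>\<omega>. ennreal \<bar>L t \<omega> - L s \<omega>\<bar>) = ennreal K"
        by (cases "esssup M (\<lambda>\<omega>. ennreal \<bar>L t \<omega> - L s \<omega>\<bar>)") auto
      have Kw: "K < k / w"
        using less K by (simp add: not_le ennreal_less_iff)
      have ts: "AE \<omega> in M. \<bar>L t \<omega> - L s \<omega>\<bar> \<le> K"
        using esssup_AE[of "\<lambda>\<omega>. ennreal \<bar>L t \<omega> - L s \<omega>\<bar>" M] unfolding K(2)
        by eventually_elim (use K(1) in simp)
      \<comment> \<open>Condition (2) controls increments by the distance of their left end to \<open>T\<close>, so the
        increment is first shortened until both end points are equally far from \<open>T\<close> up to a factor 2.\<close>
      define r where "r = max s (2 * t - T)"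
      have r: "0 \<le> r" "s \<le> r" "r < t" "t < T" "T - r \<le> 2 * (T - t)"
        using s t unfolding r_def by auto
      \<comment> \<open>Conditioning puts \<open>L r\<close> within \<open>K\<close> of
        \<open>L s\<close>, as \<open>L t\<close> is; the triangle inequality then gives
        \<open>2 * K\<close> between \<open>L t\<close> and \<open>L r\<close>.\<close>
      have "AE \<omega> in M. \<bar>L r \<omega> - L s \<omega>\<bar> \<le> K"
        using increment_bound_backward[of s r t K] ts r s by simp
      with ts have "AE \<omega> in M. \<bar>L t \<omega> - L r \<omega>\<bar> \<le> 2 * K"
        by eventually_elim linarith
      from increment_bound_ge[OF c ge small r(1,3,4) this]
      have "c / (T - r) powr (1 - \<theta>) \<le> (2 * K)\<^sup>2" .
      then have cK: "c \<le> 4 * K\<^sup>2 * (T - r) powr (1 - \<theta>)"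
        using r by (simp add: pos_divide_le_eq power_mult_distrib)
      have "(T - r) powr (1 - \<theta>) \<le> (2 * (T - t)) powr (1 - \<theta>)"
        using r \<theta> by (intro powr_mono2) auto
      also have "\<dots> = 2 powr (1 - \<theta>) * w\<^sup>2"
        using r(4) powr_mult[of 2 "T - t" "1 - \<theta>"] unfolding w(2) by simp
      also have "\<dots> \<le> 2 * w\<^sup>2"
        using powr_mono[of "1 - \<theta>" 1 "2::real"] \<theta> by (intro mult_right_mono) auto
      finally have "4 * K\<^sup>2 * (T - r) powr (1 - \<theta>) \<le> 4 * K\<^sup>2 * (2 * w\<^sup>2)"
        by (rule mult_left_mono) simp
      with cK have "k\<^sup>2 \<le> (K * w)\<^sup>2"
        unfolding k(2) power_mult_distrib by simp
      then have "k \<le> K * w"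
        by (rule power2_le_imp_le) (use K(1) w(1) in simp)
      then show False
        using Kw w(1) by (simp add: field_simps)
    qed
    then have "ennreal (k / w) \<le> lower_osc M L t"
      unfolding lower_osc_def by (rule INF_greatest)
    then have "ennreal w * ennreal (k / w) \<le> ennreal w * lower_osc M L t"
      by (rule mult_left_mono) simp
    then show ?thesis
      using w(1) k(1) unfolding w_def[symmetric] by (simp flip: ennreal_mult)
  qed
  then have "ennreal k \<le> (INF t\<in>{0<..<T}. ennreal ((T - t) powr ((1 - \<theta>) / 2)) * lower_osc M L t)"
    by (rule INF_greatest)
  then show ?thesis
    using k(1) by (simp add: less_le_trans[where y="ennreal k"])
qed

end

theorem theorem2:
  fixes M :: "'a measure" and F :: "real \<Rightarrow> 'a measure" and T \<theta> :: real
    and L :: "real \<Rightarrow> 'a \<Rightarrow> real"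
  assumes "stochastic_basis M F T"
    and "0 < \<theta>" "\<theta> \<le> 1"
    and "cadlag M T L"
    and "martingale M F T L"
    and "\<forall>t\<in>{0..<T}. integrable M (\<lambda>\<omega>. (L t \<omega>)\<^sup>2)"
    and "\<forall>\<tau>\<in>time_nets T. BMO1_norm M F T (approx_error L \<tau>) < \<infinity>"
    and "\<forall>\<epsilon>>0. \<exists>\<delta>>0. \<forall>\<tau>\<in>time_nets T. mesh T 1 \<tau> < \<delta> \<longrightarrow>
           BMO1_norm M F T (approx_error L \<tau>) < ennreal \<epsilon>"
  shows "(INF t\<in>{0<..<T}. ennreal ((T - t) powr ((1 - \<theta>) / 2)) * lower_osc M L t) > 0 \<longleftrightarrow>
         (\<exists>c>0. \<forall>\<tau>\<in>time_nets T.
            BMO1_norm M F T (approx_error L \<tau>) \<ge> ennreal (c * mesh T \<theta> \<tau>))"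
proof -
  interpret stochastic_basis M F T
    by fact
  interpret cadlag_martingale M F T L
    by unfold_locales (use assms in auto)
  show ?thesis
  proof
    assume "0 < (INF t\<in>{0<..<T}. ennreal ((T - t) powr ((1 - \<theta>) / 2)) * lower_osc M L t)"
    then show "\<exists>c>0. \<forall>\<tau>\<in>time_nets T.
        BMO1_norm M F T (approx_error L \<tau>) \<ge> ennreal (c * mesh T \<theta> \<tau>)"
      by (rule BMO1_norm_ge_mesh[OF assms(3)])
  next
    assume "\<exists>c>0. \<forall>\<tau>\<in>time_nets T.
        BMO1_norm M F T (approx_error L \<tau>) \<ge> ennreal (c * mesh T \<theta> \<tau>)"
    then obtain c where "c > 0" "\<forall>\<tau>\<in>time_nets T.
        BMO1_norm M F T (approx_error L \<tau>) \<ge> ennreal (c * mesh T \<theta> \<tau>)"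
      by metis
    then show "0 < (INF t\<in>{0<..<T}. ennreal ((T - t) powr ((1 - \<theta>) / 2)) * lower_osc M L t)"
      using assms(2,3,8) by (intro lower_osc_pos[of \<theta> c]) (simp_all only: less_imp_le)
  qed
qed

end
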